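(* There exists a constant $C>1$ such that the following holds. Let $p=p(n)$ satisfy $C\log n/n \leq p \leq 0.99$ and let $G\sim G(n,p)$. Then, with probability tending to $1$ as $n\to\infty$, for every vertex $r\in V(G)$ there exist $\delta(G)$ independent spanning trees of $G$ rooted at $r$.
   Context: $G(n,p)$ is the binomial random graph on $n$ vertices in which each of the $\binom n2$ possible edges appears independently with probability $p$; $\log$ is the natural logarithm; $\delta(G)$ is the minimum degree of $G$. Spanning trees $T_1,\dots,T_k$ of a graph $G$, all rooted at the same vertex $r$, are called independent spanning trees rooted at $r$ if for every vertex $v\in V(G)$ the unique $r$–$v$ paths in $T_1,\dots,T_k$ are pairwise internally vertex-disjoint (i.e. any two of them share no vertices other than $r$ and $v$). *)

theory Defs
  imports "HOL-Probability.Probability" "HOL-Library.Ramsey"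
begin

text \<open>
  A finite simple graph is given by a vertex set \<open>V\<close> and a set \<open>E \<subseteq> [V]\<^bsup>2\<^esup>\<close> of two-element edges.
  The AFP entry Graph_Theory is not used: its \<open>forest\<close> and \<open>tree\<close> exclude directed cycles
  only (and count a pair of opposite arcs as a cycle), so they do not describe trees in undirected
  graphs.
\<close>

definition graph_path :: "'a set \<Rightarrow> 'a set set \<Rightarrow> 'a \<Rightarrow> 'a list \<Rightarrow> 'a \<Rightarrow> bool" where
  "graph_path V E u xs v \<longleftrightarrow>
     xs \<noteq> [] \<and> hd xs = u \<and> last xs = v \<and> set xs \<subseteq> V \<and> distinct xs \<and>
     successively (\<lambda>x y. {x, y} \<in> E) xs"

definition graph_cycle :: "'a set \<Rightarrow> 'a set set \<Rightarrow> 'a list \<Rightarrow> bool" where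
  "graph_cycle V E xs \<longleftrightarrow>
     3 \<le> length xs \<and> set xs \<subseteq> V \<and> distinct xs \<and>
     successively (\<lambda>x y. {x, y} \<in> E) xs \<and> {last xs, hd xs} \<in> E"

definition connected_graph :: "'a set \<Rightarrow> 'a set set \<Rightarrow> bool" where
  "connected_graph V E \<longleftrightarrow> V \<noteq> {} \<and> (\<forall>u\<in>V. \<forall>v\<in>V. \<exists>xs. graph_path V E u xs v)"

definition tree :: "'a set \<Rightarrow> 'a set set \<Rightarrow> bool" where
  "tree V E \<longleftrightarrow> E \<subseteq> [V]\<^bsup>2\<^esup> \<and> connected_graph V E \<and> (\<nexists>xs. graph_cycle V E xs)"

text \<open>A spanning tree is identified with its edge set.\<close>

definition spanning_tree :: "'a set \<Rightarrow> 'a set set \<Rightarrow> 'a set set \<Rightarrow> bool" where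
  "spanning_tree V E T \<longleftrightarrow> T \<subseteq> E \<and> tree V T"

text \<open>
  As \<open>S\<close> and \<open>T\<close> are spanning trees, \<open>xs\<close> and \<open>ys\<close> below range over one path each. They are allowed
  to share the edge from \<open>r\<close> to \<open>v\<close>. The trees form a set, so they are counted without repetition.
\<close>

definition independent_spanning_trees ::
    "'a set \<Rightarrow> 'a set set \<Rightarrow> 'a \<Rightarrow> 'a set set set \<Rightarrow> bool" where
  "independent_spanning_trees V E r \<T> \<longleftrightarrow>
     (\<forall>T\<in>\<T>. spanning_tree V E T) \<and>
     (\<forall>S\<in>\<T>. \<forall>T\<in>\<T>. S \<noteq> T \<longrightarrow>
        (\<forall>v\<in>V. \<forall>xs ys. graph_path V S r xs v \<longrightarrow> graph_path V T r ys v \<longrightarrow> set xs \<inter> set ys \<subseteq> {r, v}))"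

definition vertex_degree :: "'a set set \<Rightarrow> 'a \<Rightarrow> nat" where
  "vertex_degree E v = card {e \<in> E. v \<in> e}"

definition min_degree :: "'a set \<Rightarrow> 'a set set \<Rightarrow> nat" where
  "min_degree V E = Min (vertex_degree E ` V)"

text \<open>
  The binomial random graph on the vertex set \<open>{..<n}\<close>, as a distribution on edge sets. Outside
  \<open>[0, 1]\<close> the parameter \<open>p\<close> is clipped by \<open>bernoulli_pmf\<close>.
\<close>

definition binomial_random_graph :: "nat \<Rightarrow> real \<Rightarrow> nat set set pmf" where
  "binomial_random_graph n p =
     map_pmf (\<lambda>X. {e \<in> [{..<n}]\<^bsup>2\<^esup>. X e})
       (Pi_pmf ([{..<n}]\<^bsup>2\<^esup>) False (\<lambda>_. bernoulli_pmf p))"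

end

(*
  Fix a root r and let k be the minimum degree. Suppose that V - {r} contains disjoint sets
  D 0, ..., D (k - 1) which together cover the neighbourhood of r, such that every vertex of D i is
  joined to r by a path inside D i. The i-th tree is built from D i, with each vertex outside D i that
  has a neighbour in D i attached to such a neighbour of least depth. A vertex v without a neighbour
  in D i is attached to one of its neighbours that does have a neighbour in D i, and these
  neighbours of v must be distinct for distinct i. As the number of remaining neighbours is only
  guaranteed to be the number of remaining indices, this is a perfect matching problem at every v.

  The random graph is exposed in three independent rounds of equal density. If p > 1/40, the sets
  D i are just a partition of the neighbourhood of r. Otherwise each of them contains a connected
  "segment" of about 1/(40 p) vertices: the first round provides many disjoint segments, and the
  second one matches the neighbours of r to segments. In either case a vertex is adjacent to D i
  through the third round with probability bounded away from 0, so that at every v the auxiliary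
  bipartite graph between indices and neighbours is random with constant density and parts of size
  of order n p. It violates Hall's condition with probability exp(-c n p), and n p >= C ln n with C
  large leaves room for a union bound over r, v and k.
*)

theory Submission
  imports Defs "HOL-Real_Asymp.Real_Asymp"
begin

section \<open>Spanning trees given by parent functions\<close>

text \<open>Two dependencies shape the proof. The minimum degree and the neighbourhood of
  \<open>r\<close> depend on all three rounds. Therefore the failure events range over every
  \<open>k \<le> n\<close>, and the matchings use only edges that stay random after all edges at
  \<open>r\<close>, and for the matching at \<open>v\<close> also those at \<open>v\<close>, are
  revealed. Moreover, the failure probability of Hall's condition decays like exp(-c n p) only if
  the number of candidate neighbours is itself of order n p, which the count of neighbours against
  indices does not give when few indices are left. This is secured by a constant fraction of
  vertices outside all branches: \<open>v\<close> has many third-round neighbours there, and none of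
  them is taken as the parent of \<open>v\<close> in a tree to which \<open>v\<close> is attached
  directly. In the dense case these outside vertices are the non-neighbours of \<open>r\<close>, so
  \<open>p\<close> must stay away from 1. In the sparse case fewer than 3 n p neighbours of
  \<open>r\<close>, each with a segment of at most 1/(20 p) vertices, occupy less than n/4
  vertices.\<close>

lemma walk_imp_graph_path:
  assumes "xs \<noteq> []" "hd xs = u" "last xs = v" "set xs \<subseteq> V" "successively (\<lambda>x y. {x, y} \<in> E) xs"
  shows "\<exists>ys. graph_path V E u ys v"
  using assms
proof (induction "length xs" arbitrary: xs rule: less_induct)
  case less
  show ?case
  proof (cases "distinct xs")
    case True
    with less.prems show ?thesis by (auto simp: graph_path_def)
  next
    case False
    then obtain as x bs cs where xs: "xs = as @ [x] @ bs @ [x] @ cs"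
      using not_distinct_decomp by blast
    let ?ys = "as @ [x] @ cs"
    have "length ?ys < length xs" by (simp add: xs)
    moreover have "hd ?ys = u" "last ?ys = v" "set ?ys \<subseteq> V"
      using less.prems unfolding xs by (cases as; cases cs; auto)+
    moreover have "successively (\<lambda>x y. {x, y} \<in> E) ?ys"
      using less.prems(5) unfolding xs by (auto simp: successively_append_iff successively_Cons)
    ultimately show ?thesis using less.hyps[of ?ys] by auto
  qed
qed

lemma graph_path_sym: "graph_path V E u xs v \<Longrightarrow> graph_path V E v (rev xs) u"
  by (auto simp: graph_path_def hd_rev last_rev insert_commute)

lemma graph_path_trans:
  assumes "graph_path V E u xs v" "graph_path V E v ys w"
  shows "\<exists>zs. graph_path V E u zs w"
proof (cases "tl ys = []")
  case True
  with assms have "v = w" by (cases ys) (auto simp: graph_path_def)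
  with assms show ?thesis by blast
next
  case False
  then obtain y ys' where ys: "ys = v # y # ys'"
    using assms(2) by (cases ys; cases "tl ys") (auto simp: graph_path_def)
  show ?thesis
    by (rule walk_imp_graph_path[of "xs @ y # ys'"])
      (use assms in \<open>auto simp: graph_path_def ys successively_append_iff\<close>)
qed

text \<open>A rank decreasing along \<open>par\<close> makes its iterates end in \<open>r\<close>.
  It need not be the distance to \<open>r\<close>, so that the trees can be ranked by branch
  depths.\<close>

locale parent_tree =
  fixes V :: "'a set" and r :: 'a and par :: "'a \<Rightarrow> 'a" and rank :: "'a \<Rightarrow> nat"
  assumes root: "r \<in> V"
    and par_in: "v \<in> V - {r} \<Longrightarrow> par v \<in> V"
    and rank_less: "v \<in> V - {r} \<Longrightarrow> rank (par v) < rank v"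
begin

definition edges :: "'a set set" where
  "edges = (\<lambda>v. {v, par v}) ` (V - {r})"

lemma edges_iff: "{x, y} \<in> edges \<longleftrightarrow> x \<in> V - {r} \<and> y = par x \<or> y \<in> V - {r} \<and> x = par y"
  unfolding edges_def by (auto simp: doubleton_eq_iff image_iff)

lemma path_to_root: "v \<in> V \<Longrightarrow> \<exists>xs. graph_path V edges v xs r"
proof (induction "rank v" arbitrary: v rule: less_induct)
  case less
  show ?case
  proof (cases "v = r")
    case True
    then have "graph_path V edges v [r] r" by (auto simp: graph_path_def root)
    then show ?thesis by blast
  next
    case False
    with less.prems have v: "v \<in> V - {r}" by blast
    obtain xs where xs: "graph_path V edges (par v) xs r"
      using less.hyps[OF rank_less[OF v] par_in[OF v]] by blast
    have "graph_path V edges v [v, par v] (par v)"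
      using v par_in[OF v] rank_less[OF v] by (auto simp: graph_path_def edges_def)
    from graph_path_trans[OF this xs] show ?thesis .
  qed
qed

lemma connected: "connected_graph V edges"
  unfolding connected_graph_def
proof (intro conjI ballI)
  show "V \<noteq> {}" using root by blast
next
  fix u v assume "u \<in> V" "v \<in> V"
  then obtain xs ys where "graph_path V edges u xs r" "graph_path V edges v ys r"
    using path_to_root by metis
  then show "\<exists>zs. graph_path V edges u zs v" using graph_path_trans graph_path_sym by metis
qed

text \<open>Both cycle neighbours of a vertex of maximal rank would have to be its parent, but on at
  least three vertices they are distinct.\<close>

lemma acyclic: "\<not> graph_cycle V edges xs"
proof
  assume cyc: "graph_cycle V edges xs"
  define n where "n = length xs"
  have n: "3 \<le> n" using cyc by (auto simp: graph_cycle_def n_def)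
  have step: "{xs ! i, xs ! (Suc i mod n)} \<in> edges" if "i < n" for i
  proof (cases "Suc i = n")
    case True
    then have "last xs = xs ! i" "hd xs = xs ! 0"
      using n last_conv_nth[of xs] hd_conv_nth[of xs] by (fastforce simp: n_def)+
    then show ?thesis using cyc True by (auto simp: graph_cycle_def)
  next
    case False
    then show ?thesis using cyc that
      by (auto simp: graph_cycle_def successively_conv_nth n_def)
  qed
  have "finite (rank ` set xs)" "rank ` set xs \<noteq> {}" using n by (auto simp: n_def)
  from Max_in[OF this] obtain i where i: "i < n" "rank (xs ! i) = Max (rank ` set xs)"
    by (auto simp: in_set_conv_nth n_def)
  then have max: "rank (xs ! j) \<le> rank (xs ! i)" if "j < n" for j
    using that by (auto simp: n_def)
  have up: "y = par (xs ! i)" if "{xs ! i, y} \<in> edges" "y = xs ! j" "j < n" for y j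
    using that max[of j] rank_less[of y] unfolding edges_iff by fastforce
  define j where "j = Suc i mod n"
  define l where "l = (if i = 0 then n - 1 else i - 1)"
  have jl: "j < n" "l < n" "j \<noteq> l" "Suc l mod n = i"
    using n i by (auto simp: j_def l_def mod_Suc split: if_splits)
  have "xs ! j = par (xs ! i)" using up[of "xs ! j" j] step[of i] i jl by (simp add: j_def)
  moreover have "xs ! l = par (xs ! i)" using up[of "xs ! l" l] step[of l] jl by (simp add: insert_commute)
  ultimately show False
    using jl cyc nth_eq_iff_index_eq[of xs j l] by (auto simp: graph_cycle_def n_def)
qed

lemma tree: "tree V edges"
proof -
  have "edges \<subseteq> [V]\<^bsup>2\<^esup>"
    using par_in rank_less unfolding edges_def by fastforce
  then show ?thesis using connected acyclic by (auto simp: tree_def)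
qed

text \<open>By induction from \<open>r\<close>, which has no parent. If the next vertex were the
  parent of the current one, the path would return to its previous vertex.\<close>

lemma path_from_root_step:
  assumes "graph_path V edges r xs v" "Suc i < length xs"
  shows "xs ! i = par (xs ! Suc i) \<and> xs ! Suc i \<in> V - {r}"
  using assms(2)
proof (induction i)
  case 0
  have "{xs ! 0, xs ! Suc 0} \<in> edges" "xs ! 0 = r"
    using assms(1) 0 by (auto simp: graph_path_def successively_conv_nth hd_conv_nth)
  then show ?case by (auto simp: edges_iff)
next
  case (Suc i)
  have e: "{xs ! Suc i, xs ! Suc (Suc i)} \<in> edges" and d: "distinct xs"
    using assms(1) Suc.prems by (auto simp: graph_path_def successively_conv_nth)
  have "xs ! Suc (Suc i) \<noteq> xs ! i" using d Suc.prems by (simp add: nth_eq_iff_index_eq)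
  then show ?case using e Suc.IH Suc.prems by (auto simp: edges_iff)
qed

text \<open>Read backwards, the path iterates \<open>par\<close> from \<open>v\<close>. The first
  iterate is listed separately because \<open>par v\<close> may lie outside the branch described by
  \<open>P\<close>.\<close>

lemma path_from_root_invariant:
  assumes path: "graph_path V edges r xs v"
    and step: "\<And>x. x \<in> V - {r} \<Longrightarrow> P x \<or> x = par v \<Longrightarrow> par x = r \<or> P (par x)"
  shows "\<forall>x \<in> set xs - {r, v}. P x \<or> x = par v"
proof -
  define n where "n = length xs"
  have ne: "n > 0" and last: "xs ! (n - 1) = v"
    using path by (auto simp: graph_path_def n_def last_conv_nth)
  \<comment> \<open>Index \<open>n - 1\<close> is \<open>v\<close> and \<open>n - 2\<close> its
    parent; \<open>j\<close> counts the further steps towards \<open>r\<close>.\<close>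
  have "xs ! (n - 2 - j) = r \<or> P (xs ! (n - 2 - j)) \<or> xs ! (n - 2 - j) = par v" if "j + 2 \<le> n" for j
    using that
  proof (induction j)
    case 0
    then have "Suc (n - 2) < length xs" "Suc (n - 2) = n - 1" by (auto simp: n_def)
    from path_from_root_step[OF path this(1)] this(2) show ?case using last by simp
  next
    case (Suc j)
    define i where "i = n - 2 - Suc j"
    have i: "Suc i < length xs" "Suc i = n - 2 - j" using Suc.prems by (auto simp: i_def n_def)
    note * = path_from_root_step[OF path i(1)]
    have "xs ! Suc i = r \<or> P (xs ! Suc i) \<or> xs ! Suc i = par v" using Suc i(2) by simp
    then show ?case using * step[of "xs ! Suc i"] unfolding i_def[symmetric] by auto
  qed
  note backward = this
  have "xs ! i = r \<or> P (xs ! i) \<or> xs ! i = par v" if "i + 2 \<le> n" for i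
  proof -
    have "n - 2 - (n - 2 - i) = i" "n - 2 - i + 2 \<le> n" using that by auto
    with backward[of "n - 2 - i"] show ?thesis by simp
  qed
  moreover have "i + 2 \<le> n" if "i < n" "xs ! i \<noteq> v" for i
    using that last by (cases "i = n - 1") auto
  ultimately have "xs ! i = r \<or> xs ! i = v \<or> P (xs ! i) \<or> xs ! i = par v" if "i < n" for i
    using that by blast
  then show ?thesis unfolding n_def by (metis Diff_iff in_set_conv_nth insertCI)
qed

end

section \<open>Independent trees from disjoint branches\<close>

definition nb :: "'a set set \<Rightarrow> 'a \<Rightarrow> 'a set" where
  "nb E v = {y. {v, y} \<in> E}"

lemma nb_iff: "y \<in> nb E v \<longleftrightarrow> {v, y} \<in> E"
  by (simp add: nb_def)

lemma nb_sym: "y \<in> nb E v \<longleftrightarrow> v \<in> nb E y"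
  by (simp add: nb_def insert_commute)

lemma nb_subset: "E \<subseteq> [V]\<^bsup>2\<^esup> \<Longrightarrow> nb E v \<subseteq> V - {v}"
proof
  fix y assume "E \<subseteq> [V]\<^bsup>2\<^esup>" "y \<in> nb E v"
  then have "{v, y} \<in> [V]\<^bsup>2\<^esup>" unfolding nb_def by blast
  then show "y \<in> V - {v}" unfolding doubleton_in_nsets_2 by blast
qed

lemma vertex_degree_eq_card_nb:
  assumes "E \<subseteq> [V]\<^bsup>2\<^esup>"
  shows "vertex_degree E v = card (nb E v)"
proof -
  have "{e \<in> E. v \<in> e} = (\<lambda>y. {v, y}) ` nb E v"
  proof (intro equalityI subsetI)
    fix e assume e: "e \<in> {e \<in> E. v \<in> e}"
    then have "e \<in> [V]\<^bsup>2\<^esup>" using assms by blast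
    then obtain x y where "e = {x, y}" by (rule nsets2_E)
    with e have "e = {v, x} \<or> e = {v, y}" by auto
    with e show "e \<in> (\<lambda>y. {v, y}) ` nb E v" by (auto simp: nb_def)
  qed (auto simp: nb_def)
  moreover have "inj_on (\<lambda>y. {v, y}) (nb E v)"
    by (auto simp: inj_on_def doubleton_eq_iff)
  ultimately show ?thesis by (simp add: vertex_degree_def card_image)
qed

text \<open>
  \<open>branch_index\<close> collects the indices of the trees in which \<open>v\<close> is attached directly to the branch
  \<open>D i\<close> or to \<open>r\<close>, and \<open>up_vertex\<close> is the parent of \<open>v\<close> in such a tree (an unspecified vertex for
  other \<open>i\<close>). Every neighbour of \<open>r\<close> lies in exactly one branch, so that an edge at \<open>r\<close> is the
  first step of exactly one of the paths.
\<close>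

definition branch_index :: "'a set set \<Rightarrow> 'a \<Rightarrow> nat \<Rightarrow> (nat \<Rightarrow> 'a set) \<Rightarrow> 'a \<Rightarrow> nat set" where
  "branch_index E r k D v = {i. i < k \<and> (D i \<inter> nb E v \<noteq> {} \<or> v \<in> D i \<and> v \<in> nb E r)}"

definition up_vertex ::
    "'a set set \<Rightarrow> 'a \<Rightarrow> (nat \<Rightarrow> 'a set) \<Rightarrow> ('a \<Rightarrow> nat) \<Rightarrow> 'a \<Rightarrow> nat \<Rightarrow> 'a" where
  "up_vertex E r D d v i = (if v \<in> D i \<and> v \<in> nb E r then r else arg_min_on d (D i \<inter> nb E v))"

text \<open>\<open>d\<close> is any function that can be decreased inside a branch until a neighbour
  of \<open>r\<close> is reached. \<open>D_root\<close> serves to make the trees distinct, as they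
  are counted as a set.\<close>

locale branching =
  fixes V :: "'a set" and E :: "'a set set" and r :: 'a and k :: nat
    and D :: "nat \<Rightarrow> 'a set" and d :: "'a \<Rightarrow> nat"
  assumes finite_V: "finite V" and root: "r \<in> V" and E_sub: "E \<subseteq> [V]\<^bsup>2\<^esup>"
    and D_sub: "i < k \<Longrightarrow> D i \<subseteq> V - {r}"
    and D_root: "i < k \<Longrightarrow> D i \<inter> nb E r \<noteq> {}"
    and D_disj: "disjoint_family_on D {..<k}"
    and D_cover: "nb E r \<subseteq> (\<Union>i<k. D i)"
    and descent: "i < k \<Longrightarrow> x \<in> D i \<Longrightarrow> x \<in> nb E r \<or> (\<exists>y \<in> D i. y \<in> nb E x \<and> d y < d x)"
begin

abbreviation "J \<equiv> branch_index E r k D"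

abbreviation "up \<equiv> up_vertex E r D d"

lemma J_less: "i \<in> J v \<Longrightarrow> i < k"
  by (simp add: branch_index_def)

lemma finite_J: "finite (J v)"
  by (rule finite_subset[of _ "{..<k}"]) (auto simp: branch_index_def)

lemma D_finite: "i < k \<Longrightarrow> finite (D i)"
  using D_sub finite_V by (meson finite_Diff finite_subset)

lemma D_unique: "x \<in> D i \<Longrightarrow> x \<in> D j \<Longrightarrow> i < k \<Longrightarrow> j < k \<Longrightarrow> i = j"
  using D_disj by (auto simp: disjoint_family_on_def)

lemma mem_J: "i < k \<Longrightarrow> v \<in> D i \<Longrightarrow> i \<in> J v"
  using descent[of i v] by (auto simp: branch_index_def)

lemma up_root: "v \<in> D i \<Longrightarrow> v \<in> nb E r \<Longrightarrow> up v i = r"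
  by (simp add: up_vertex_def)

lemma up_branch:
  assumes "i \<in> J v" "\<not> (v \<in> D i \<and> v \<in> nb E r)"
  shows "up v i \<in> D i \<inter> nb E v" and "y \<in> D i \<inter> nb E v \<Longrightarrow> d (up v i) \<le> d y"
proof -
  have ne: "D i \<inter> nb E v \<noteq> {}" and up: "up v i = arg_min_on d (D i \<inter> nb E v)"
    using assms by (auto simp: branch_index_def up_vertex_def)
  have fin: "finite (D i \<inter> nb E v)" using D_finite J_less[OF assms(1)] by simp
  show "up v i \<in> D i \<inter> nb E v" unfolding up by (rule arg_min_if_finite(1)[OF fin ne])
  show "d (up v i) \<le> d y" if "y \<in> D i \<inter> nb E v"
    unfolding up by (rule arg_min_least[OF fin ne that])
qed

lemma up_nb: "i \<in> J v \<Longrightarrow> up v i \<in> nb E v"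
  using up_branch(1)[of i v] nb_sym[of v E r] by (cases "v \<in> D i \<and> v \<in> nb E r") (auto simp: up_root)

lemma up_cases: "i \<in> J v \<Longrightarrow> up v i = r \<or> up v i \<in> D i"
  using up_branch(1)[of i v] by (cases "v \<in> D i \<and> v \<in> nb E r") (auto simp: up_root)

lemma up_eq_root: "i \<in> J v \<Longrightarrow> up v i = r \<Longrightarrow> v \<in> D i"
  using up_branch(1)[of i v] D_sub[OF J_less] by (cases "v \<in> D i \<and> v \<in> nb E r") auto

lemma up_descent:
  assumes "i < k" "v \<in> D i"
  shows "up v i = r \<or> up v i \<in> D i \<and> d (up v i) < d v"
proof (cases "v \<in> nb E r")
  case False
  with assms have "i \<in> J v" using mem_J by simp
  moreover obtain y where "y \<in> D i" "y \<in> nb E v" "d y < d v" using descent[OF assms] False by blast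
  ultimately show ?thesis using up_branch[of i v] False by fastforce
qed (use assms in \<open>simp add: up_root\<close>)

text \<open>Removing \<open>r\<close> costs nothing: if \<open>r\<close> is adjacent to
  \<open>v\<close>, then \<open>D_cover\<close> puts \<open>v\<close> into a branch, and
  \<open>r\<close> is already a value of \<open>up v\<close>.\<close>

lemma card_J_le: "card (nb E v) - card (J v) \<le> card (nb E v - {r} - up v ` J v)"
proof -
  have "r \<in> up v ` J v" if "r \<in> nb E v"
  proof -
    have "v \<in> nb E r" using that nb_sym[of r E v] by simp
    then obtain i where "i < k" "v \<in> D i" using D_cover by blast
    then show ?thesis using mem_J up_root \<open>v \<in> nb E r\<close> by force
  qed
  then have "nb E v - {r} - up v ` J v = nb E v - up v ` J v" by auto
  then show ?thesis
    using diff_card_le_card_Diff[of "up v ` J v" "nb E v"] card_image_le[of "J v" "up v"] finite_J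
    by (simp add: le_trans)
qed

text \<open>
  The first vertices of the \<open>k\<close> paths from \<open>v\<close> to \<open>r\<close> are distinct neighbours of \<open>v\<close>; by the choice
  of \<open>up\<close> as a minimiser of the depth, all later internal vertices of the \<open>i\<close>-th path lie in
  \<open>D i\<close> and are not adjacent to \<open>v\<close>.
\<close>

theorem independent:
  assumes match: "\<And>v. v \<in> V - {r} \<Longrightarrow> \<exists>f. inj_on f ({..<k} - J v) \<and>
      (\<forall>i \<in> {..<k} - J v. f i \<in> nb E v - {r} - up v ` J v \<and> i \<in> J (f i))"
  shows "\<exists>\<T>. card \<T> = k \<and> independent_spanning_trees V E r \<T>"
proof -
  obtain m where m_inj: "\<And>v. v \<in> V - {r} \<Longrightarrow> inj_on (m v) ({..<k} - J v)"
    and m: "\<And>v i. v \<in> V - {r} \<Longrightarrow> i < k \<Longrightarrow> i \<notin> J v \<Longrightarrow>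
      m v i \<in> nb E v \<and> m v i \<noteq> r \<and> m v i \<notin> up v ` J v \<and> i \<in> J (m v i)"
    using match by (simp add: Ball_def) metis
  define par where "par = (\<lambda>i v. if i \<in> J v then up v i else m v i)"
  \<comment> \<open>Four levels: \<open>r\<close>, the branch by depth, vertices attached to the
    branch, and vertices attached through one of these. \<open>sum d V\<close> is just a bound on
    all depths.\<close>
  define rank where "rank = (\<lambda>i v. if v = r then 0 else if v \<in> D i then Suc (d v)
      else if i \<in> J v then Suc (Suc (sum d V)) else Suc (Suc (Suc (sum d V))))"
  have par_nb: "par i v \<in> nb E v" if "i < k" "v \<in> V - {r}" for i v
    using that up_nb[of i v] m[of v i] by (auto simp: par_def)
  have d_le: "d x \<le> sum d V" if "x \<in> V" for x
    using finite_V that by (simp add: member_le_sum)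
  have ranked: "parent_tree V r (par i) (rank i)" if i: "i < k" for i
  proof
    show "r \<in> V" by (rule root)
  next
    fix v assume v: "v \<in> V - {r}"
    show "par i v \<in> V" using par_nb[OF i v] nb_subset[OF E_sub] by blast
    show "rank i (par i v) < rank i v"
    proof (cases "v \<in> D i")
      case True
      then show ?thesis using up_descent[OF i True] mem_J[OF i True] v by (auto simp: rank_def par_def)
    next
      case False
      show ?thesis
      proof (cases "i \<in> J v")
        case True
        then have "par i v = r \<or> par i v \<in> D i" using up_cases by (simp add: par_def)
        then show ?thesis using False True v d_le[of "par i v"] D_sub[OF i]
          by (auto simp: rank_def le_imp_less_Suc)
      next
        case nJ: False
        then have "i \<in> J (par i v)" "par i v \<in> V" using m[OF v i] \<open>par i v \<in> V\<close> by (auto simp: par_def)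
        then show ?thesis using False nJ v d_le[of "par i v"]
          by (auto simp: rank_def less_Suc_eq_le le_SucI)
      qed
    qed
  qed
  define T where "T = (\<lambda>i. parent_tree.edges V r (par i))"
  have T_tree: "spanning_tree V E (T i)" if i: "i < k" for i
  proof -
    interpret parent_tree V r "par i" "rank i" by (rule ranked[OF i])
    have "T i \<subseteq> E" using par_nb[OF i] by (auto simp: T_def edges_def nb_iff)
    then show ?thesis using local.tree by (simp add: spanning_tree_def T_def)
  qed
  have inner: "x = par i v \<or> x \<in> D i \<and> x \<notin> nb E v"
    if i: "i < k" and v: "v \<in> V - {r}" and xs: "graph_path V (T i) r xs v" and x: "x \<in> set xs - {r, v}"
    for i v xs x
  proof (cases "i \<in> J v")
    case True
    interpret parent_tree V r "par i" "rank i" by (rule ranked[OF i])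
    \<comment> \<open>Beyond \<open>par i v\<close> the depth drops below the least depth of a
      neighbour of \<open>v\<close> in \<open>D i\<close>, so these vertices are not adjacent to
      \<open>v\<close>.\<close>
    have "\<forall>x \<in> set xs - {r, v}. (x \<in> D i \<and> d x < d (par i v)) \<or> x = par i v"
    proof (rule path_from_root_invariant)
      show "graph_path V edges r xs v" using xs by (simp add: T_def)
      fix y assume y: "y \<in> V - {r}" "(y \<in> D i \<and> d y < d (par i v)) \<or> y = par i v"
      have "par i v = r \<or> par i v \<in> D i" using True up_cases by (simp add: par_def)
      then have "y \<in> D i" "d y \<le> d (par i v)" using y by auto
      then show "par i y = r \<or> par i y \<in> D i \<and> d (par i y) < d (par i v)"
        using up_descent[OF i \<open>y \<in> D i\<close>] mem_J[OF i \<open>y \<in> D i\<close>] by (auto simp: par_def)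
    qed
    then have "x \<in> D i \<and> d x < d (par i v) \<or> x = par i v" using x by blast
    moreover have "x \<notin> nb E v" if "x \<in> D i" "d x < d (par i v)"
    proof (cases "v \<in> D i \<and> v \<in> nb E r")
      case True
      interpret parent_tree V r "par i" "rank i" by (rule ranked[OF i])
      have "par i v = r" using True \<open>i \<in> J v\<close> by (simp add: par_def up_root)
      \<comment> \<open>The path is the single edge at \<open>r\<close>: the constant invariant
        \<open>False\<close> excludes inner vertices.\<close>
      moreover have "\<forall>x \<in> set xs - {r, v}. False \<or> x = par i v"
        by (rule path_from_root_invariant) (use xs calculation in \<open>auto simp: T_def\<close>)
      ultimately show ?thesis using x by blast
    next
      case False
      then show ?thesis using up_branch(2)[OF \<open>i \<in> J v\<close> False, of x] that \<open>i \<in> J v\<close> by (auto simp: par_def)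
    qed
    ultimately show ?thesis by blast
  next
    case False
    interpret parent_tree V r "par i" "rank i" by (rule ranked[OF i])
    have "\<forall>x \<in> set xs - {r, v}. x \<in> D i \<or> x = par i v"
    proof (rule path_from_root_invariant)
      show "graph_path V edges r xs v" using xs by (simp add: T_def)
      fix y assume "y \<in> V - {r}" "y \<in> D i \<or> y = par i v"
      then have "i \<in> J y" using mem_J[OF i] m[OF v i False] False by (auto simp: par_def)
      then show "par i y = r \<or> par i y \<in> D i" using up_cases by (simp add: par_def)
    qed
    \<comment> \<open>\<open>i \<notin> J v\<close> already says that no vertex of
      \<open>D i\<close> is adjacent to \<open>v\<close>.\<close>
    then show ?thesis using x False i by (auto simp: branch_index_def)
  qed
  have first: "par i v \<noteq> par j v" if "i < k" "j < k" "i \<noteq> j" "v \<in> V - {r}" "par i v \<noteq> r" for i j v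
  proof
    assume eq: "par i v = par j v"
    show False
    proof (cases "i \<in> J v \<and> j \<in> J v")
      case True
      then show False
        using up_cases[of i v] up_cases[of j v] that eq D_unique[of "par i v" i j] by (auto simp: par_def)
    next
      case False
      note m_i = m[OF that(4) that(1)] and m_j = m[OF that(4) that(2)]
      consider "i \<in> J v" "j \<notin> J v" | "i \<notin> J v" "j \<in> J v" | "i \<notin> J v" "j \<notin> J v"
        using False by blast
      then show False
      proof cases
        case 1
        then have "m v j = up v i" using eq by (simp add: par_def)
        then have "m v j \<in> up v ` J v" using 1 by blast
        with m_j 1 show False by blast
      next
        case 2
        then have "m v i = up v j" using eq by (simp add: par_def)
        then have "m v i \<in> up v ` J v" using 2 by blast
        with m_i 2 show False by blast
      next
        case 3
        then show False using that eq inj_onD[OF m_inj[OF that(4)], of i j] by (auto simp: par_def)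
      qed
    qed
  qed
  have indep: "set xs \<inter> set ys \<subseteq> {r, v}"
    if ij: "i < k" "j < k" "i \<noteq> j" and v: "v \<in> V"
      and xs: "graph_path V (T i) r xs v" and ys: "graph_path V (T j) r ys v" for i j v xs ys
  proof (cases "v = r")
    case True
    obtain x xs' where "xs = x # xs'" using xs by (cases xs) (auto simp: graph_path_def)
    then have "set xs = {r}"
      using xs True last_in_set[of xs'] by (cases "xs' = []") (auto simp: graph_path_def)
    then show ?thesis by blast
  next
    case False
    then have v': "v \<in> V - {r}" using v by simp
    show ?thesis
    proof
      fix x assume x: "x \<in> set xs \<inter> set ys"
      show "x \<in> {r, v}"
      proof (rule ccontr)
        assume "x \<notin> {r, v}"
        then have "x = par i v \<or> x \<in> D i \<and> x \<notin> nb E v" "x = par j v \<or> x \<in> D j \<and> x \<notin> nb E v" "x \<noteq> r"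
          using inner[OF ij(1) v' xs] inner[OF ij(2) v' ys] x by auto
        then show False
          using first[OF ij v'] par_nb[OF ij(1) v'] par_nb[OF ij(2) v'] D_unique[of x i j] ij by auto
      qed
    qed
  qed
  \<comment> \<open>Edges at \<open>r\<close> tell the trees apart: a neighbour of \<open>r\<close>
    in \<open>D i\<close> has \<open>r\<close> as parent in no tree but \<open>T i\<close>, since
    \<open>m\<close> avoids \<open>r\<close>.\<close>
  have "inj_on T {..<k}"
  proof (rule inj_onI)
    fix i j assume "i \<in> {..<k}" "j \<in> {..<k}" and eq: "T i = T j"
    then have ij: "i < k" "j < k" by auto
    obtain x where x: "x \<in> D i" "x \<in> nb E r" using D_root[OF ij(1)] by blast
    then have xV: "x \<in> V - {r}" using D_sub[OF ij(1)] by blast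
    have "par i x = r" using x mem_J[OF ij(1)] by (simp add: par_def up_root)
    then have "{x, r} \<in> T i"
      using xV parent_tree.edges_iff[OF ranked[OF ij(1)]] by (simp add: T_def)
    then have "par j x = r"
      using eq parent_tree.edges_iff[OF ranked[OF ij(2)], of x r] by (auto simp: T_def)
    then have "x \<in> D j"
      using up_eq_root[of j x] m[OF xV ij(2)] by (auto simp: par_def split: if_splits)
    then show "i = j" using D_unique x ij by blast
  qed
  then have "card (T ` {..<k}) = k" by (simp add: card_image)
  moreover have "independent_spanning_trees V E r (T ` {..<k})"
    unfolding independent_spanning_trees_def
  proof (intro conjI ballI impI allI)
    fix S assume "S \<in> T ` {..<k}"
    then show "spanning_tree V E S" using T_tree by auto
  next
    fix S S' v xs ys
    assume "S \<in> T ` {..<k}" "S' \<in> T ` {..<k}" "S \<noteq> S'" "v \<in> V"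
      "graph_path V S r xs v" "graph_path V S' r ys v"
    then show "set xs \<inter> set ys \<subseteq> {r, v}" using indep by blast
  qed
  ultimately show ?thesis by blast
qed

end

section \<open>Hall's theorem and random subsets\<close>

text \<open>If all nonempty proper subsets of \<open>L\<close> have a surplus, one element is
  matched arbitrarily, which costs each of them at most one neighbour. Otherwise a tight set
  \<open>A\<close> is matched into its own neighbourhood, and tightness passes Hall's condition on
  to \<open>L - A\<close> with that neighbourhood removed.\<close>

theorem hall_marriage:
  assumes "finite L" "\<And>l. l \<in> L \<Longrightarrow> finite (\<Gamma> l)" "\<And>A. A \<subseteq> L \<Longrightarrow> card A \<le> card (\<Union>l\<in>A. \<Gamma> l)"
  shows "\<exists>f. inj_on f L \<and> (\<forall>l\<in>L. f l \<in> \<Gamma> l)"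
  using assms
proof (induction "card L" arbitrary: L \<Gamma> rule: less_induct)
  case less
  note fin = less.prems(1) and fin\<Gamma> = less.prems(2) and hall = less.prems(3)
  have finU: "finite (\<Union>l\<in>A. \<Gamma> l)" if "A \<subseteq> L" for A
    using that fin fin\<Gamma> by (meson finite_UN_I finite_subset subsetD)
  consider "L = {}" | "L \<noteq> {}" "\<And>A. A \<subset> L \<Longrightarrow> A \<noteq> {} \<Longrightarrow> card A < card (\<Union>l\<in>A. \<Gamma> l)"
    | A where "A \<subset> L" "A \<noteq> {}" "card A = card (\<Union>l\<in>A. \<Gamma> l)"
    using hall by (metis le_neq_implies_less psubset_imp_subset)
  then show ?case
  proof cases
    case 1
    then show ?thesis by simp
  next
    case 2
    then obtain l where l: "l \<in> L" by blast
    with hall[of "{l}"] obtain x where x: "x \<in> \<Gamma> l" by fastforce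
    have "\<exists>f. inj_on f (L - {l}) \<and> (\<forall>i\<in>L - {l}. f i \<in> \<Gamma> i - {x})"
    proof (rule less.hyps)
      show "card (L - {l}) < card L" using l fin by (meson card_Diff1_less)
      show "finite (L - {l})" using fin by simp
      show "finite (\<Gamma> i - {x})" if "i \<in> L - {l}" for i using that fin\<Gamma> by simp
      fix A assume A: "A \<subseteq> L - {l}"
      show "card A \<le> card (\<Union>i\<in>A. \<Gamma> i - {x})"
      proof (cases "A = {}")
        case False
        have "(\<Union>i\<in>A. \<Gamma> i - {x}) = (\<Union>i\<in>A. \<Gamma> i) - {x}" by auto
        moreover have "card A < card (\<Union>i\<in>A. \<Gamma> i)" using 2(2)[of A] A l False by blast
        ultimately show ?thesis
          using diff_card_le_card_Diff[of "{x}" "\<Union>i\<in>A. \<Gamma> i"] by simp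
      qed simp
    qed
    then obtain f where f: "inj_on f (L - {l})" "\<forall>i\<in>L - {l}. f i \<in> \<Gamma> i - {x}" by blast
    then have "inj_on (f(l := x)) L" by (auto simp: inj_on_def)
    moreover have "\<forall>i\<in>L. (f(l := x)) i \<in> \<Gamma> i" using f x by auto
    ultimately show ?thesis by blast
  next
    case 3
    have AL: "A \<subseteq> L" using 3 by blast
    have "\<exists>f. inj_on f A \<and> (\<forall>l\<in>A. f l \<in> \<Gamma> l)"
    proof (rule less.hyps)
      show "card A < card L" using 3 fin psubset_card_mono by blast
      show "finite A" using AL fin finite_subset by blast
      show "finite (\<Gamma> l)" if "l \<in> A" for l using that AL fin\<Gamma> by blast
      show "card B \<le> card (\<Union>l\<in>B. \<Gamma> l)" if "B \<subseteq> A" for B using that AL hall by blast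
    qed
    then obtain f where f: "inj_on f A" "\<forall>l\<in>A. f l \<in> \<Gamma> l" by blast
    let ?N = "\<Union>l\<in>A. \<Gamma> l"
    have "\<exists>g. inj_on g (L - A) \<and> (\<forall>l\<in>L - A. g l \<in> \<Gamma> l - ?N)"
    proof (rule less.hyps)
      show "card (L - A) < card L" using 3 fin by (intro psubset_card_mono) auto
      show "finite (L - A)" using fin by simp
      show "finite (\<Gamma> l - ?N)" if "l \<in> L - A" for l using that fin\<Gamma> by simp
      fix B assume B: "B \<subseteq> L - A"
      have "card A + card B = card (A \<union> B)"
        using B AL fin by (intro card_Un_disjoint[symmetric]) (auto intro: finite_subset)
      also have "\<dots> \<le> card (\<Union>l\<in>A \<union> B. \<Gamma> l)" using B AL by (intro hall) auto
      also have "\<dots> \<le> card (?N \<union> (\<Union>l\<in>B. \<Gamma> l - ?N))"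
        using B AL by (intro card_mono finite_UnI finU) (auto intro: finite_subset[OF _ finU[of B]])
      also have "\<dots> \<le> card ?N + card (\<Union>l\<in>B. \<Gamma> l - ?N)" by (rule card_Un_le)
      finally show "card B \<le> card (\<Union>l\<in>B. \<Gamma> l - ?N)" using 3(3) by simp
    qed
    then obtain g where g: "inj_on g (L - A)" "\<forall>l\<in>L - A. g l \<in> \<Gamma> l - ?N" by blast
    define h where "h = (\<lambda>l. if l \<in> A then f l else g l)"
    have fg: "g x \<noteq> f y" "f y \<noteq> g x" if "x \<in> L - A" "y \<in> A" for x y
    proof -
      have "g x \<notin> ?N" "f y \<in> ?N" using f(2) g(2) that by blast+
      then show "g x \<noteq> f y" "f y \<noteq> g x" by metis+
    qed
    have "inj_on h L"
    proof (rule inj_onI)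
      fix x y assume "x \<in> L" "y \<in> L" "h x = h y"
      then show "x = y"
        using f g fg by (cases "x \<in> A"; cases "y \<in> A") (auto simp: h_def dest: inj_onD)
    qed
    moreover have "\<forall>l\<in>L. h l \<in> \<Gamma> l" using f g by (auto simp: h_def)
    ultimately show ?thesis by blast
  qed
qed

section \<open>Random subsets: independence, superposition and tail bounds\<close>

definition random_subset :: "'a set \<Rightarrow> real \<Rightarrow> 'a set pmf" where
  "random_subset I q = map_pmf (\<lambda>X. {e \<in> I. X e}) (Pi_pmf I False (\<lambda>_. bernoulli_pmf q))"

lemma binomial_random_graph_eq: "binomial_random_graph n p = random_subset ([{..<n}]\<^bsup>2\<^esup>) p"
  by (simp add: binomial_random_graph_def random_subset_def)

lemma set_pmf_random_subset: "set_pmf (random_subset I q) \<subseteq> Pow I"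
  unfolding random_subset_def set_map_pmf by blast

lemma finite_set_pmf_random_subset: "finite I \<Longrightarrow> finite (set_pmf (random_subset I q))"
  by (rule finite_subset[OF set_pmf_random_subset]) simp

lemma random_subset_Un:
  assumes "finite A" "finite B" "A \<inter> B = {}"
  shows "random_subset (A \<union> B) q =
    map_pmf (\<lambda>(X, Y). X \<union> Y) (pair_pmf (random_subset A q) (random_subset B q))"
proof -
  have "random_subset (A \<union> B) q = map_pmf (\<lambda>(f, g). {e \<in> A. f e} \<union> {e \<in> B. g e})
      (pair_pmf (Pi_pmf A False (\<lambda>_. bernoulli_pmf q)) (Pi_pmf B False (\<lambda>_. bernoulli_pmf q)))"
    unfolding random_subset_def Pi_pmf_union[OF assms] map_pmf_comp
    using assms(3) by (intro map_pmf_cong refl) (auto split: if_splits)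
  also have "\<dots> = map_pmf (\<lambda>(X, Y). X \<union> Y) (pair_pmf (random_subset A q) (random_subset B q))"
    unfolding random_subset_def map_pair[symmetric] map_pmf_comp
    by (intro map_pmf_cong refl) auto
  finally show ?thesis .
qed

lemma random_subset_insert:
  assumes "finite I" "e \<notin> I"
  shows "random_subset (insert e I) q = bind_pmf (bernoulli_pmf q)
    (\<lambda>b. bind_pmf (random_subset I q) (\<lambda>X. return_pmf (if b then insert e X else X)))"
proof -
  have "{x \<in> insert e I. (f(e := b)) x} = (if b then insert e {x \<in> I. f x} else {x \<in> I. f x})" for f b
    using assms by auto
  then show ?thesis
    by (simp add: random_subset_def Pi_pmf_insert'[OF assms] map_bind_pmf bind_map_pmf)
qed

lemma bernoulli_or:
  assumes "0 \<le> p" "p \<le> 1" "0 \<le> q" "q \<le> 1"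
  shows "bind_pmf (bernoulli_pmf p) (\<lambda>b. bind_pmf (bernoulli_pmf q) (\<lambda>c. return_pmf (b \<or> c))) =
    bernoulli_pmf (p + q - p * q)"
proof (rule pmf_eqI)
  fix x
  have "0 \<le> (1 - p) * (1 - q)" "p * q \<le> q" "0 \<le> p * q"
    using assms by (auto intro: mult_left_le_one_le)
  then have "0 \<le> p + q - p * q" "p + q - p * q \<le> 1" using assms by (auto simp: algebra_simps)
  then show "pmf (bind_pmf (bernoulli_pmf p) (\<lambda>b. bind_pmf (bernoulli_pmf q) (\<lambda>c. return_pmf (b \<or> c)))) x =
      pmf (bernoulli_pmf (p + q - p * q)) x"
    using assms by (cases x) (auto simp: pmf_bind algebra_simps)
qed

text \<open>Element by element: exchanging independent draws brings the two coins for
  \<open>e\<close> together, and \<open>bernoulli_or\<close> merges them into one.\<close>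

lemma random_subset_superpose:
  assumes "finite I" and pq: "0 \<le> p" "p \<le> 1" "0 \<le> q" "q \<le> 1"
  shows "bind_pmf (random_subset I p) (\<lambda>X. bind_pmf (random_subset I q) (\<lambda>Y. return_pmf (X \<union> Y))) =
    random_subset I (p + q - p * q)"
  using assms(1)
proof (induction I rule: finite_induct)
  case empty
  then show ?case by (simp add: random_subset_def bind_return_pmf)
next
  case (insert e I)
  let ?b = "\<lambda>b X. if b then insert e X else X"
  have un: "?b b X \<union> ?b c Y = ?b (b \<or> c) (X \<union> Y)" for b c X Y by auto
  have "bind_pmf (random_subset (insert e I) p) (\<lambda>X. bind_pmf (random_subset (insert e I) q) (\<lambda>Y. return_pmf (X \<union> Y))) =
    bind_pmf (bernoulli_pmf p) (\<lambda>b. bind_pmf (random_subset I p) (\<lambda>X. bind_pmf (bernoulli_pmf q)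
      (\<lambda>c. bind_pmf (random_subset I q) (\<lambda>Y. return_pmf (?b (b \<or> c) (X \<union> Y))))))"
    unfolding random_subset_insert[OF insert.hyps] bind_assoc_pmf bind_return_pmf un ..
  also have "\<dots> = bind_pmf (bernoulli_pmf p) (\<lambda>b. bind_pmf (bernoulli_pmf q) (\<lambda>c. bind_pmf (random_subset I p)
      (\<lambda>X. bind_pmf (random_subset I q) (\<lambda>Y. return_pmf (?b (b \<or> c) (X \<union> Y))))))"
    by (intro bind_pmf_cong refl) (rule bind_commute_pmf)
  also have "\<dots> = bind_pmf (bind_pmf (bernoulli_pmf p) (\<lambda>b. bind_pmf (bernoulli_pmf q) (\<lambda>c. return_pmf (b \<or> c))))
      (\<lambda>a. bind_pmf (bind_pmf (random_subset I p) (\<lambda>X. bind_pmf (random_subset I q) (\<lambda>Y. return_pmf (X \<union> Y))))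
        (\<lambda>Z. return_pmf (?b a Z)))"
    unfolding bind_assoc_pmf bind_return_pmf ..
  also have "\<dots> = random_subset (insert e I) (p + q - p * q)"
    unfolding bernoulli_or[OF pq] insert.IH random_subset_insert[OF insert.hyps] ..
  finally show ?case .
qed

text \<open>A product of independent factors, one for each element of \<open>T\<close>. Taking
  \<open>z\<close> as 0, 1/2 or 2, or \<open>w\<close> as 1/2, gives the avoidance and tail bounds
  below through Markov's inequality.\<close>

lemma random_subset_expectation:
  assumes I: "finite I" "T \<subseteq> I" and q: "0 \<le> q" "q \<le> 1" and "0 \<le> z" "0 \<le> w"
  shows "measure_pmf.expectation (random_subset I q) (\<lambda>\<omega>. z ^ card (\<omega> \<inter> T) * w ^ card (T - \<omega>)) =
    (q * z + (1 - q) * w) ^ card T"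
proof -
  let ?f = "\<lambda>e b. if e \<in> T then if b then z else w else (1::real)"
  have fT: "finite T" using I finite_subset by blast
  have prod: "(\<Prod>e\<in>I. ?f e (X e)) = z ^ card ({e \<in> I. X e} \<inter> T) * w ^ card (T - {e \<in> I. X e})" for X
  proof -
    have "(\<Prod>e\<in>I. ?f e (X e)) = (\<Prod>e\<in>T. if X e then z else w)"
      using I by (intro prod.mono_neutral_cong_right) auto
    also have "\<dots> = (\<Prod>e\<in>T \<inter> Collect X. z) * (\<Prod>e\<in>T \<inter> - Collect X. w)"
      using prod.If_cases[OF fT, of X "\<lambda>_. z" "\<lambda>_. w"] by simp
    moreover have "T \<inter> Collect X = {e \<in> I. X e} \<inter> T" "T \<inter> - Collect X = T - {e \<in> I. X e}"
      using I(2) by auto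
    ultimately show ?thesis by simp
  qed
  have "measure_pmf.expectation (random_subset I q) (\<lambda>\<omega>. z ^ card (\<omega> \<inter> T) * w ^ card (T - \<omega>)) =
      measure_pmf.expectation (Pi_pmf I False (\<lambda>_. bernoulli_pmf q)) (\<lambda>X. \<Prod>e\<in>I. ?f e (X e))"
    unfolding random_subset_def integral_map_pmf prod ..
  also have "\<dots> = (\<Prod>e\<in>I. measure_pmf.expectation (bernoulli_pmf q) (?f e))"
    using assms by (intro expectation_prod_Pi_pmf) (auto intro: integrable_measure_pmf_finite)
  also have "\<dots> = (\<Prod>e\<in>I. if e \<in> T then q * z + (1 - q) * w else 1)"
    using q by (intro prod.cong refl) auto
  also have "\<dots> = (\<Prod>e\<in>T. q * z + (1 - q) * w)"
    using I by (intro prod.mono_neutral_cong_right) auto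
  finally show ?thesis by simp
qed

lemma prob_le_expectation:
  assumes "finite (set_pmf M)" "\<And>x. x \<in> set_pmf M \<Longrightarrow> 0 \<le> g x" "\<And>x. x \<in> set_pmf M \<Longrightarrow> x \<in> S \<Longrightarrow> 1 \<le> g x"
  shows "measure_pmf.prob M S \<le> measure_pmf.expectation M g"
proof -
  have "measure_pmf.prob M S = measure_pmf.expectation M (indicator S)" by simp
  also have "\<dots> \<le> measure_pmf.expectation M g"
    using assms by (intro integral_mono_AE integrable_measure_pmf_finite)
      (auto simp: AE_measure_pmf_iff indicator_def)
  finally show ?thesis .
qed

lemma one_minus_power_le_exp:
  assumes "0 \<le> q" "q \<le> (1::real)"
  shows "(1 - q) ^ n \<le> exp (- q * real n)"
proof -
  have "(1 - q) ^ n \<le> exp (- q) ^ n"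
    using assms exp_ge_add_one_self[of "- q"] by (intro power_mono) auto
  also have "\<dots> = exp (- q * real n)" by (simp add: exp_of_nat_mult[symmetric] mult.commute)
  finally show ?thesis .
qed

lemma random_subset_avoid:
  assumes "finite I" "T \<subseteq> I" "0 \<le> q" "q \<le> 1"
  shows "measure_pmf.prob (random_subset I q) {\<omega>. \<omega> \<inter> T = {}} \<le> exp (- q * real (card T))"
proof -
  \<comment> \<open>As \<open>0 ^ 0 = 1\<close>, the integrand is the indicator of the
    event.\<close>
  have "measure_pmf.prob (random_subset I q) {\<omega>. \<omega> \<inter> T = {}} \<le>
      measure_pmf.expectation (random_subset I q) (\<lambda>\<omega>. 0 ^ card (\<omega> \<inter> T) * 1 ^ card (T - \<omega>))"
    using assms by (intro prob_le_expectation finite_set_pmf_random_subset) auto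
  also have "\<dots> = (1 - q) ^ card T" using assms by (subst random_subset_expectation) auto
  also have "\<dots> \<le> exp (- q * real (card T))" using assms by (intro one_minus_power_le_exp)
  finally show ?thesis .
qed

lemma random_subset_lower_tail:
  assumes "finite I" "T \<subseteq> I" "0 \<le> q" "q \<le> 1"
  shows "measure_pmf.prob (random_subset I q) {\<omega>. real (card (\<omega> \<inter> T)) \<le> a} \<le>
    2 powr a * exp (- q * real (card T) / 2)"
proof -
  have "measure_pmf.prob (random_subset I q) {\<omega>. real (card (\<omega> \<inter> T)) \<le> a} \<le>
      measure_pmf.expectation (random_subset I q) (\<lambda>\<omega>. 2 powr a * ((1/2) ^ card (\<omega> \<inter> T) * 1 ^ card (T - \<omega>)))"
  proof (intro prob_le_expectation finite_set_pmf_random_subset assms)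
    fix \<omega> assume "\<omega> \<in> {\<omega>. real (card (\<omega> \<inter> T)) \<le> a}"
    then have "(2::real) powr real (card (\<omega> \<inter> T)) \<le> 2 powr a" by simp
    then show "1 \<le> 2 powr a * ((1/2) ^ card (\<omega> \<inter> T) * 1 ^ card (T - \<omega>))"
      by (simp add: powr_realpow power_one_over field_simps)
  qed auto
  also have "\<dots> = 2 powr a * (1 - q / 2) ^ card T"
    using assms by (simp only: integral_mult_right_zero) (subst random_subset_expectation, auto)
  also have "\<dots> \<le> 2 powr a * exp (- (q / 2) * real (card T))"
    using assms by (intro mult_left_mono one_minus_power_le_exp) auto
  finally show ?thesis by simp
qed

lemma random_subset_complement_lower_tail:
  assumes "finite I" "T \<subseteq> I" "0 \<le> q" "q \<le> 1"
  shows "measure_pmf.prob (random_subset I q) {\<omega>. real (card (T - \<omega>)) \<le> a} \<le>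
    2 powr a * exp (- (1 - q) * real (card T) / 2)"
proof -
  have "measure_pmf.prob (random_subset I q) {\<omega>. real (card (T - \<omega>)) \<le> a} \<le>
      measure_pmf.expectation (random_subset I q) (\<lambda>\<omega>. 2 powr a * (1 ^ card (\<omega> \<inter> T) * (1/2) ^ card (T - \<omega>)))"
  proof (intro prob_le_expectation finite_set_pmf_random_subset assms)
    fix \<omega> assume "\<omega> \<in> {\<omega>. real (card (T - \<omega>)) \<le> a}"
    then have "(2::real) powr real (card (T - \<omega>)) \<le> 2 powr a" by simp
    then show "1 \<le> 2 powr a * (1 ^ card (\<omega> \<inter> T) * (1/2) ^ card (T - \<omega>))"
      by (simp add: powr_realpow power_one_over field_simps)
  qed auto
  also have "\<dots> = 2 powr a * (q * 1 + (1 - q) * (1/2)) ^ card T"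
    using assms by (simp only: integral_mult_right_zero) (subst random_subset_expectation, auto)
  also have "q * 1 + (1 - q) * (1/2) = 1 - (1 - q) / 2" by (simp add: field_simps)
  also have "2 powr a * (1 - (1 - q) / 2) ^ card T \<le> 2 powr a * exp (- ((1 - q) / 2) * real (card T))"
    using assms by (intro mult_left_mono one_minus_power_le_exp) auto
  also have "- ((1 - q) / 2) * real (card T) = - (1 - q) * real (card T) / 2" by (simp add: field_simps)
  finally show ?thesis .
qed

lemma random_subset_upper_tail:
  assumes "finite I" "T \<subseteq> I" "0 \<le> q" "q \<le> 1"
  shows "measure_pmf.prob (random_subset I q) {\<omega>. a \<le> real (card (\<omega> \<inter> T))} \<le>
    2 powr (- a) * exp (q * real (card T))"
proof -
  have "measure_pmf.prob (random_subset I q) {\<omega>. a \<le> real (card (\<omega> \<inter> T))} \<le>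
      measure_pmf.expectation (random_subset I q) (\<lambda>\<omega>. 2 powr (- a) * (2 ^ card (\<omega> \<inter> T) * 1 ^ card (T - \<omega>)))"
  proof (intro prob_le_expectation finite_set_pmf_random_subset assms)
    fix \<omega> assume "\<omega> \<in> {\<omega>. a \<le> real (card (\<omega> \<inter> T))}"
    then have "(2::real) powr a \<le> 2 powr real (card (\<omega> \<inter> T))" by simp
    then show "1 \<le> 2 powr (- a) * (2 ^ card (\<omega> \<inter> T) * 1 ^ card (T - \<omega>))"
      by (simp add: powr_realpow powr_minus field_simps)
  qed auto
  also have "\<dots> = 2 powr (- a) * (1 + q) ^ card T"
    using assms by (simp only: integral_mult_right_zero) (subst random_subset_expectation, auto simp: algebra_simps)
  also have "\<dots> \<le> 2 powr (- a) * exp q ^ card T"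
    using assms exp_ge_add_one_self[of q] by (intro mult_left_mono power_mono) auto
  also have "exp q ^ card T = exp (q * real (card T))" by (simp add: exp_of_nat_mult[symmetric] mult.commute)
  finally show ?thesis .
qed

section \<open>Hall's condition in a random bipartite graph\<close>

lemma card_nsets:
  assumes "finite A"
  shows "card ([A]\<^bsup>k\<^esup>) = card A choose k"
proof -
  have "[A]\<^bsup>k\<^esup> = {B. B \<subseteq> A \<and> card B = k}"
    using finite_subset[OF _ assms] by (auto simp: nsets_def)
  then show ?thesis by (simp add: n_subsets[OF assms])
qed

text \<open>
  Hall's condition fails only if there are \<open>A \<subseteq> L\<close> and \<open>Y \<subseteq> R\<close> with \<open>card A + card Y = card R + 1\<close>
  and no edge in between. With \<open>u\<close> the smaller of the two cardinalities, there are at most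
  \<open>(card R)\<^sup>2\<^sup>u\<close> such pairs and at least \<open>s * u * card R / 2\<close> forbidden elements for each of them.
\<close>

lemma random_matching:
  fixes T :: "'l \<Rightarrow> 'r \<Rightarrow> 'i set"
  assumes I: "finite I" and q: "0 \<le> q" "q \<le> 1" and L: "finite L" and R: "finite R" and LR: "card L \<le> card R"
    and T: "\<And>l x. l \<in> L \<Longrightarrow> x \<in> R \<Longrightarrow> T l x \<subseteq> I \<and> s \<le> card (T l x)"
    and disj: "\<And>l x l' x'. l \<in> L \<Longrightarrow> x \<in> R \<Longrightarrow> l' \<in> L \<Longrightarrow> x' \<in> R \<Longrightarrow> T l x \<inter> T l' x' \<noteq> {} \<Longrightarrow> l = l' \<and> x = x'"
  shows "measure_pmf.prob (random_subset I q)
      {\<omega>. \<not> (\<exists>f. inj_on f L \<and> (\<forall>l\<in>L. f l \<in> R \<and> \<omega> \<inter> T l (f l) \<noteq> {}))} \<le>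
    real (card R) ^ 3 * exp (- q * real s * real (card R) / 2)" (is "measure_pmf.prob _ ?bad \<le> _")
proof -
  let ?P = "measure_pmf.prob (random_subset I q)"
  define m where "m = card R"
  define c where "c = real m ^ 2 * exp (- q * real s * real m / 2)"
  define F where "F = (\<lambda>A Y. {\<omega>. \<omega> \<inter> (\<Union>(l, x)\<in>A \<times> Y. T l x) = {}})"
  have c0: "0 \<le> c" by (simp add: c_def)
  have goal: "real (card R) ^ 3 * exp (- q * real s * real (card R) / 2) = real m * c"
    by (simp add: c_def m_def power3_eq_cube power2_eq_square)
  show ?thesis
  \<comment> \<open>For \<open>m \<ge> 1\<close> and \<open>c > 1\<close> the bound exceeds 1.
    Otherwise \<open>c ^ u \<le> c\<close> bounds each layer \<open>t\<close>, and
    \<open>m = 0\<close> leaves no layers.\<close>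
  proof (cases "m \<ge> 1 \<and> c > 1")
    case True
    have "?P ?bad \<le> 1" by simp
    also have "1 \<le> real m * c" using True mult_mono[of 1 "real m" 1 c] by simp
    finally show ?thesis unfolding goal .
  next
    case False
    have pair: "?P (F A Y) \<le> exp (- q * (real s * (real t * real (m + 1 - t))))"
      if "A \<in> [L]\<^bsup>t\<^esup>" "Y \<in> [R]\<^bsup>(m + 1 - t)\<^esup>" for A Y t
    proof -
      have AY: "A \<subseteq> L" "Y \<subseteq> R" "card A = t" "card Y = m + 1 - t" "finite A" "finite Y"
        using that by (auto simp: nsets_def)
      have sub: "(\<Union>(l, x)\<in>A \<times> Y. T l x) \<subseteq> I" using AY T by blast
      have fT: "finite (T l x)" if "l \<in> L" "x \<in> R" for l x using T[OF that] I finite_subset by blast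
      have "card (\<Union>(l, x)\<in>A \<times> Y. T l x) = (\<Sum>(l, x)\<in>A \<times> Y. card (T l x))"
      proof (subst card_UN_disjoint)
        show "\<forall>i\<in>A \<times> Y. finite (case i of (l, x) \<Rightarrow> T l x)"
          using AY(1,2) by (auto intro!: fT)
        show "\<forall>i\<in>A \<times> Y. \<forall>j\<in>A \<times> Y. i \<noteq> j \<longrightarrow>
            (case i of (l, x) \<Rightarrow> T l x) \<inter> (case j of (l, x) \<Rightarrow> T l x) = {}"
        proof (intro ballI impI)
          fix i j assume ij: "i \<in> A \<times> Y" "j \<in> A \<times> Y" "i \<noteq> j"
          obtain l x l' x' where eq: "i = (l, x)" "j = (l', x')" by (cases i; cases j)
          then have "l \<in> L" "x \<in> R" "l' \<in> L" "x' \<in> R" "\<not> (l = l' \<and> x = x')" using ij AY by auto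
          then have "T l x \<inter> T l' x' = {}" using disj by metis
          then show "(case i of (l, x) \<Rightarrow> T l x) \<inter> (case j of (l, x) \<Rightarrow> T l x) = {}"
            using eq by simp
        qed
      qed (use AY in \<open>auto simp: split_beta\<close>)
      also have "\<dots> \<ge> (\<Sum>(l, x)\<in>A \<times> Y. s)"
        using AY T by (intro sum_mono) auto
      finally have "t * (m + 1 - t) * s \<le> card (\<Union>(l, x)\<in>A \<times> Y. T l x)"
        using AY by (simp add: card_cartesian_product split_beta)
      then have "real (t * (m + 1 - t) * s) \<le> real (card (\<Union>(l, x)\<in>A \<times> Y. T l x))"
        by (rule of_nat_mono)
      then have "q * (real s * (real t * real (m + 1 - t))) \<le> q * real (card (\<Union>(l, x)\<in>A \<times> Y. T l x))"
        using q by (intro mult_left_mono) (simp_all add: mult_ac)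
      moreover have "?P (F A Y) \<le> exp (- q * real (card (\<Union>(l, x)\<in>A \<times> Y. T l x)))"
        unfolding F_def by (rule random_subset_avoid[OF I sub q])
      ultimately show ?thesis by (smt (verit) exp_le_cancel_iff mult_minus_left)
    qed
    have layer: "(\<Sum>A\<in>[L]\<^bsup>t\<^esup>. \<Sum>Y\<in>[R]\<^bsup>(m + 1 - t)\<^esup>. ?P (F A Y)) \<le> c" if t: "t \<in> {1..m}" for t
    proof -
      define u where "u = min t (m + 1 - t)"
      have u: "1 \<le> u" "m \<ge> 1" using t by (auto simp: u_def)
      have "m \<le> 2 * max t (m + 1 - t)" using t by auto
      then have "u * m \<le> u * (2 * max t (m + 1 - t))" by (intro mult_le_mono2)
      also have "\<dots> = 2 * (t * (m + 1 - t))" by (auto simp: u_def min_def max_def)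
      finally have um: "real u * real m \<le> 2 * (real t * real (m + 1 - t))"
        by (metis of_nat_le_iff of_nat_mult of_nat_numeral)
      have mono: "m ^ i \<le> m ^ j" if "i \<le> j" for i j using that u by (intro power_increasing) auto
      \<comment> \<open>By symmetry of the binomial coefficient, both \<open>m ^ t\<close> and
        \<open>m ^ (m - t)\<close> are upper bounds.\<close>
      have c1: "m choose t \<le> m ^ u"
        using t le_trans[OF binomial_le_pow[of "m - t" m] mono[of "m - t" "m + 1 - t"]]
          binomial_le_pow[of t m] binomial_symmetric[of t m] by (auto simp: u_def min_def)
      have "card L choose t \<le> m choose t" using LR by (simp add: m_def binomial_right_mono)
      with c1 have cL: "card L choose t \<le> m ^ u" by linarith
      have cR: "m choose (m + 1 - t) \<le> m ^ u"
        using t le_trans[OF binomial_le_pow[of "t - 1" m] mono[of "t - 1" t]]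
          binomial_le_pow[of "m + 1 - t" m] binomial_symmetric[of "t - 1" m]
        by (auto simp: u_def min_def Suc_diff_le)
      have cards: "card ([L]\<^bsup>t\<^esup>) = card L choose t" "card ([R]\<^bsup>(m + 1 - t)\<^esup>) = m choose (m + 1 - t)"
        using card_nsets L R by (auto simp: m_def)
      have "(\<Sum>A\<in>[L]\<^bsup>t\<^esup>. \<Sum>Y\<in>[R]\<^bsup>(m + 1 - t)\<^esup>. ?P (F A Y)) \<le>
          (\<Sum>A\<in>[L]\<^bsup>t\<^esup>. \<Sum>Y\<in>[R]\<^bsup>(m + 1 - t)\<^esup>. exp (- q * (real s * (real t * real (m + 1 - t)))))"
        using pair by (intro sum_mono)
      also have "\<dots> = real (card L choose t) * (real (m choose (m + 1 - t)) *
          exp (- q * (real s * (real t * real (m + 1 - t)))))"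
        by (simp add: cards) (simp add: m_def)
      also have "\<dots> \<le> real (m ^ u) * (real (m ^ u) * exp (- q * real s * real m / 2 * real u))"
      proof (intro mult_mono of_nat_mono cL cR)
        have "q * real s * (real u * real m) \<le> q * real s * (2 * (real t * real (m + 1 - t)))"
          using um q by (intro mult_left_mono) auto
        then show "exp (- q * (real s * (real t * real (m + 1 - t)))) \<le> exp (- q * real s * real m / 2 * real u)"
          by (simp add: mult_ac)
      qed auto
      also have "\<dots> = c ^ u"
        by (simp add: c_def power_mult_distrib exp_of_nat_mult[symmetric] mult.commute power2_eq_square)
      also have "\<dots> \<le> c" using c0 u False power_decreasing[of 1 u c] by auto
      finally show ?thesis .
    qed
    have "?bad \<subseteq> (\<Union>t\<in>{1..m}. \<Union>A\<in>[L]\<^bsup>t\<^esup>. \<Union>Y\<in>[R]\<^bsup>(m + 1 - t)\<^esup>. F A Y)"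
    proof
      fix \<omega> assume bad: "\<omega> \<in> ?bad"
      define \<Gamma> where "\<Gamma> = (\<lambda>l. {x \<in> R. \<omega> \<inter> T l x \<noteq> {}})"
      have "\<not> (\<forall>A. A \<subseteq> L \<longrightarrow> card A \<le> card (\<Union>l\<in>A. \<Gamma> l))"
      proof
        assume "\<forall>A. A \<subseteq> L \<longrightarrow> card A \<le> card (\<Union>l\<in>A. \<Gamma> l)"
        then have "\<exists>f. inj_on f L \<and> (\<forall>l\<in>L. f l \<in> \<Gamma> l)"
          using L R by (intro hall_marriage) (auto simp: \<Gamma>_def)
        then show False using bad unfolding \<Gamma>_def by blast
      qed
      then obtain A where A: "A \<subseteq> L" "card (\<Union>l\<in>A. \<Gamma> l) < card A" by (meson not_le)
      have NR: "(\<Union>l\<in>A. \<Gamma> l) \<subseteq> R" by (auto simp: \<Gamma>_def)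
      have Am: "card A \<le> m" using A(1) L LR card_mono[of L A] by (simp add: m_def)
      have "card (R - (\<Union>l\<in>A. \<Gamma> l)) = m - card (\<Union>l\<in>A. \<Gamma> l)"
        using NR R by (simp add: card_Diff_subset finite_subset m_def)
      then have "m + 1 - card A \<le> card (R - (\<Union>l\<in>A. \<Gamma> l))" using A(2) Am by linarith
      then obtain Y where Y: "Y \<subseteq> R - (\<Union>l\<in>A. \<Gamma> l)" "card Y = m + 1 - card A" "finite Y"
        by (rule obtain_subset_with_card_n)
      have "\<omega> \<in> F A Y" using Y A(1) by (auto simp: F_def \<Gamma>_def)
      moreover have "A \<in> [L]\<^bsup>(card A)\<^esup>" "Y \<in> [R]\<^bsup>(m + 1 - card A)\<^esup>"
        using A(1) L Y by (auto simp: nsets_def intro: finite_subset)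
      moreover have "card A \<in> {1..m}" using A(2) Am by auto
      ultimately show "\<omega> \<in> (\<Union>t\<in>{1..m}. \<Union>A\<in>[L]\<^bsup>t\<^esup>. \<Union>Y\<in>[R]\<^bsup>(m + 1 - t)\<^esup>. F A Y)" by blast
    qed
    then have "?P ?bad \<le> ?P (\<Union>t\<in>{1..m}. \<Union>A\<in>[L]\<^bsup>t\<^esup>. \<Union>Y\<in>[R]\<^bsup>(m + 1 - t)\<^esup>. F A Y)"
      by (intro measure_pmf.finite_measure_mono) auto
    also have "\<dots> \<le> (\<Sum>t\<in>{1..m}. \<Sum>A\<in>[L]\<^bsup>t\<^esup>. \<Sum>Y\<in>[R]\<^bsup>(m + 1 - t)\<^esup>. ?P (F A Y))"
      using L R
      by (intro order_trans[OF measure_pmf.finite_measure_subadditive_finite] sum_mono finite_imp_finite_nsets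
          measure_pmf.finite_measure_subadditive_finite) auto
    also have "\<dots> \<le> (\<Sum>t\<in>{1..m}. c)" using layer by (intro sum_mono)
    also have "\<dots> = real m * c" by simp
    finally show ?thesis unfolding goal .
  qed
qed

section \<open>Linked sets and the construction of branches\<close>

text \<open>Connectedness of the graph induced on \<open>A\<close>, in terms of cuts: an edge
  leaving a proper part is what the growth arguments below use.\<close>

definition linked :: "'a set set \<Rightarrow> 'a set \<Rightarrow> bool" where
  "linked E A \<longleftrightarrow> (\<forall>B\<subseteq>A. B \<noteq> {} \<longrightarrow> B \<noteq> A \<longrightarrow> (\<exists>b\<in>B. \<exists>a\<in>A - B. {b, a} \<in> E))"

lemma linked_singleton: "linked E {x}"
  unfolding linked_def by (simp add: subset_singleton_iff)

lemma linked_insert: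
  assumes "linked E A" "x \<in> A" "{x, y} \<in> E"
  shows "linked E (insert y A)"
  unfolding linked_def
proof (intro allI impI)
  fix B assume B: "B \<subseteq> insert y A" "B \<noteq> {}" "B \<noteq> insert y A"
  have link: "\<exists>b\<in>B'. \<exists>a\<in>A - B'. {b, a} \<in> E" if "B' \<subseteq> A" "B' \<noteq> {}" "B' \<noteq> A" for B'
    using assms(1) that unfolding linked_def by blast
  show "\<exists>b\<in>B. \<exists>a\<in>insert y A - B. {b, a} \<in> E"
  proof (cases "y \<in> B")
    case False
    then have BA: "B \<subseteq> A" using B by blast
    show ?thesis
    proof (cases "B = A")
      case True
      then show ?thesis using assms False by blast
    next
      case neq: False
      then show ?thesis using link[of B] BA B by blast
    qed
  next
    case True
    show ?thesis
    proof (cases "x \<in> B")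
      case False
      have "{y, x} \<in> E" using assms(3) by (simp add: insert_commute)
      then show ?thesis using True False assms(2) by blast
    next
      case xB: True
      show ?thesis
      proof (cases "y \<in> A")
        case True
        then show ?thesis using link[of B] B by (simp add: insert_absorb)
      next
        case False
        then have "x \<in> B - {y}" using assms(2) xB by blast
        moreover have "B - {y} \<subseteq> A" "B - {y} \<noteq> A" using B True False by auto
        ultimately obtain b a where "b \<in> B - {y}" "a \<in> A - (B - {y})" "{b, a} \<in> E"
          using link[of "B - {y}"] by blast
        then show ?thesis using False by blast
      qed
    qed
  qed
qed

text \<open>A maximal subset containing \<open>y\<close> with such a function is all of
  \<open>A\<close>: otherwise a vertex across the cut could be added, one deeper than its
  neighbour.\<close>

lemma linked_depth:
  assumes "finite A" "linked E A" "y \<in> A"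
  shows "\<exists>d :: 'a \<Rightarrow> nat. \<forall>x\<in>A - {y}. \<exists>z\<in>A. {x, z} \<in> E \<and> d z < d x"
proof -
  define \<F> where "\<F> = {B. y \<in> B \<and> B \<subseteq> A \<and> (\<exists>d :: 'a \<Rightarrow> nat. \<forall>x\<in>B - {y}. \<exists>z\<in>B. {x, z} \<in> E \<and> d z < d x)}"
  have "finite \<F>" by (rule finite_subset[of _ "Pow A"]) (use assms(1) in \<open>auto simp: \<F>_def\<close>)
  moreover have "{y} \<in> \<F>" using assms(3) by (auto simp: \<F>_def)
  ultimately obtain B where B: "B \<in> \<F>" and max: "\<And>B'. B' \<in> \<F> \<Longrightarrow> B \<subseteq> B' \<Longrightarrow> B = B'"
    using finite_has_maximal[of \<F>] by blast
  then obtain d where yB: "y \<in> B" "B \<subseteq> A" and d: "\<forall>x\<in>B - {y}. \<exists>z\<in>B. {x, z} \<in> E \<and> d z < (d x :: nat)"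
    by (auto simp: \<F>_def)
  have "B = A"
  proof (rule ccontr)
    assume "B \<noteq> A"
    then obtain b a where ba: "b \<in> B" "a \<in> A - B" "{b, a} \<in> E"
      using assms(2) yB unfolding linked_def by blast
    have "\<exists>z\<in>insert a B. {x, z} \<in> E \<and> (d(a := Suc (d b))) z < (d(a := Suc (d b))) x"
      if x: "x \<in> insert a B - {y}" for x
    proof (cases "x = a")
      case True
      then show ?thesis using ba by (auto simp: insert_commute intro!: bexI[of _ b])
    next
      case False
      then obtain z where "z \<in> B" "{x, z} \<in> E" "d z < d x" using d x by blast
      moreover from this ba have "z \<noteq> a" by blast
      ultimately show ?thesis using False by auto
    qed
    then have "insert a B \<in> \<F>" using yB ba unfolding \<F>_def by blast
    then show False using max[of "insert a B"] ba by blast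
  qed
  then show ?thesis using d by blast
qed

text \<open>
  If no linked set had \<open>s\<close> elements, all components inside \<open>W\<close> would be smaller than \<open>s \<le> m\<close>, and
  collecting components would split \<open>W\<close> into two sets of size at least \<open>m\<close> without an edge between them.
\<close>

lemma linked_subset_exists:
  assumes W: "finite W" "3 * m \<le> card W" and s: "1 \<le> s" "s \<le> m"
    and expand: "\<And>X Y. X \<subseteq> W \<Longrightarrow> Y \<subseteq> W \<Longrightarrow> X \<inter> Y = {} \<Longrightarrow> m \<le> card X \<Longrightarrow> m \<le> card Y \<Longrightarrow>
      \<exists>x\<in>X. \<exists>y\<in>Y. {x, y} \<in> E"
  shows "\<exists>A\<subseteq>W. card A = s \<and> linked E A"
proof (rule ccontr)
  assume none: "\<not> (\<exists>A\<subseteq>W. card A = s \<and> linked E A)"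
  have fin: "finite A" if "A \<subseteq> W" for A using that W(1) finite_subset by blast
  \<comment> \<open>Unions of components may have up to \<open>2 * m\<close> elements, but expansion
    excludes sizes from \<open>m\<close> on, since \<open>card W \<ge> 3 * m\<close> makes the
    complement large. So a maximal \<open>U\<close> has room for one more component smaller than
    \<open>m\<close>.\<close>
  define \<U> where "\<U> = {U. U \<subseteq> W \<and> (\<forall>x\<in>U. \<forall>y\<in>W - U. {x, y} \<notin> E) \<and> card U < 2 * m}"
  have "finite \<U>" by (rule finite_subset[of _ "Pow W"]) (use W(1) in \<open>auto simp: \<U>_def\<close>)
  moreover have "{} \<in> \<U>" using s by (auto simp: \<U>_def)
  ultimately obtain U where U: "U \<in> \<U>" and maxU: "\<And>U'. U' \<in> \<U> \<Longrightarrow> U \<subseteq> U' \<Longrightarrow> U = U'"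
    using finite_has_maximal[of \<U>] by blast
  then have UW: "U \<subseteq> W" and closed: "\<forall>x\<in>U. \<forall>y\<in>W - U. {x, y} \<notin> E" and cU: "card U < 2 * m"
    by (auto simp: \<U>_def)
  have cD: "card (W - U) = card W - card U" using UW fin by (simp add: card_Diff_subset)
  have "m \<le> card (W - U)" using cD cU W(2) by linarith
  then have "card U < m" using expand[of U "W - U"] UW closed by (meson Diff_disjoint Diff_subset not_le)
  then have "W - U \<noteq> {}" using \<open>m \<le> card (W - U)\<close> by (metis card.empty not_less0 not_less_iff_gr_or_eq le_zero_eq)
  then obtain x where x: "x \<in> W - U" by blast
  define \<A> where "\<A> = {A. A \<subseteq> W - U \<and> x \<in> A \<and> linked E A \<and> card A \<le> s}"
  have "finite \<A>" by (rule finite_subset[of _ "Pow W"]) (use W(1) in \<open>auto simp: \<A>_def\<close>)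
  moreover have "{x} \<in> \<A>" using s x by (auto simp: \<A>_def linked_singleton)
  ultimately obtain A where A: "A \<in> \<A>" and maxA: "\<And>A'. A' \<in> \<A> \<Longrightarrow> A \<subseteq> A' \<Longrightarrow> A = A'"
    using finite_has_maximal[of \<A>] by blast
  then have AW: "A \<subseteq> W - U" "x \<in> A" "linked E A" "card A \<le> s" by (auto simp: \<A>_def)
  then have cA: "card A < s" using none by (metis Diff_subset le_neq_implies_less subset_trans)
  have closedA: "{a, y} \<notin> E" if "a \<in> A" "y \<in> W - U - A" for a y
  proof
    assume "{a, y} \<in> E"
    then have "linked E (insert y A)" using linked_insert AW(3) that(1) by metis
    moreover have "card (insert y A) \<le> s" 
      using cA card_insert_le_m1[of s A y] s by (simp add: card_insert_if)
    ultimately have "insert y A \<in> \<A>" using AW that by (auto simp: \<A>_def)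
    then show False using maxA[of "insert y A"] that(2) by blast
  qed
  have "card (U \<union> A) < 2 * m" using card_Un_le[of U A] \<open>card U < m\<close> cA s by linarith
  moreover have "\<forall>u\<in>U \<union> A. \<forall>y\<in>W - (U \<union> A). {u, y} \<notin> E" using closed closedA by blast
  ultimately have "U \<union> A \<in> \<U>" using UW AW by (auto simp: \<U>_def)
  then show False using maxU[of "U \<union> A"] AW x by blast
qed

text \<open>Greedy choice: as long as another set is wanted, at least \<open>3 * m\<close> vertices
  are left outside the earlier ones.\<close>

lemma linked_family_exists:
  assumes W: "finite W" "K * s + 3 * m \<le> card W" and s: "1 \<le> s" "s \<le> m"
    and expand: "\<And>X Y. X \<subseteq> W \<Longrightarrow> Y \<subseteq> W \<Longrightarrow> X \<inter> Y = {} \<Longrightarrow> m \<le> card X \<Longrightarrow> m \<le> card Y \<Longrightarrow>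
      \<exists>x\<in>X. \<exists>y\<in>Y. {x, y} \<in> E"
  shows "\<exists>Q :: nat \<Rightarrow> 'a set. (\<forall>i<K. Q i \<subseteq> W \<and> card (Q i) = s \<and> linked E (Q i)) \<and> disjoint_family_on Q {..<K}"
  using W(2)
proof (induction K)
  case 0
  then show ?case by (auto simp: disjoint_family_on_def)
next
  case (Suc K)
  then obtain Q where Q: "\<forall>i<K. Q i \<subseteq> W \<and> card (Q i) = s \<and> linked E (Q i)" "disjoint_family_on Q {..<K}"
    by fastforce
  define W' where "W' = W - (\<Union>i<K. Q i)"
  have QW: "(\<Union>i<K. Q i) \<subseteq> W" using Q by auto
  have "card (\<Union>i<K. Q i) \<le> (\<Sum>i<K. card (Q i))" by (rule card_UN_le) simp
  also have "\<dots> = K * s" using Q by simp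
  finally have "card W - K * s \<le> card W'"
    using QW W(1) by (simp add: W'_def card_Diff_subset finite_subset)
  then have "3 * m \<le> card W'" using Suc.prems by simp
  moreover have "finite W'" "W' \<subseteq> W" using W(1) by (auto simp: W'_def)
  moreover have "\<exists>A\<subseteq>W'. card A = s \<and> linked E A"
  proof (rule linked_subset_exists[of W' m s E])
    fix X Y assume "X \<subseteq> W'" "Y \<subseteq> W'" "X \<inter> Y = {}" "m \<le> card X" "m \<le> card Y"
    then show "\<exists>x\<in>X. \<exists>y\<in>Y. {x, y} \<in> E" using expand[of X Y] \<open>W' \<subseteq> W\<close> by blast
  qed (use calculation s in auto)
  ultimately obtain A where A: "A \<subseteq> W'" "card A = s" "linked E A" by blast
  have "\<forall>i<Suc K. (Q(K := A)) i \<subseteq> W \<and> card ((Q(K := A)) i) = s \<and> linked E ((Q(K := A)) i)"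
    using Q A \<open>W' \<subseteq> W\<close> by (auto simp: less_Suc_eq)
  moreover have "disjoint_family_on (Q(K := A)) {..<Suc K}"
    unfolding disjoint_family_on_def
  proof (intro ballI impI)
    fix i j assume ij: "i \<in> {..<Suc K}" "j \<in> {..<Suc K}" "i \<noteq> j"
    have "A \<inter> Q l = {}" if "l < K" for l using A(1) that by (auto simp: W'_def)
    moreover have "Q i \<inter> Q j = {}" if "i < K" "j < K"
      using Q(2) ij(3) that by (auto simp: disjoint_family_on_def)
    ultimately show "(Q(K := A)) i \<inter> (Q(K := A)) j = {}"
      using ij by (auto simp: less_Suc_eq)
  qed
  ultimately show ?case by blast
qed

text \<open>\<open>N\<close> is meant as the neighbourhood of \<open>r\<close> in the whole graph,
  while \<open>E\<close> supplies only the edges for the descent inside the branches. Thus branches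
  can be determined from two rounds and the edges at \<open>r\<close>.\<close>

definition branch_structure ::
    "'a set \<Rightarrow> 'a set set \<Rightarrow> 'a \<Rightarrow> 'a set \<Rightarrow> nat \<Rightarrow> (nat \<Rightarrow> 'a set) \<Rightarrow> ('a \<Rightarrow> nat) \<Rightarrow> bool" where
  "branch_structure V E r N k D d \<longleftrightarrow>
     (\<forall>i<k. D i \<subseteq> V - {r} \<and> D i \<inter> N \<noteq> {}) \<and> disjoint_family_on D {..<k} \<and> N \<subseteq> (\<Union>i<k. D i) \<and>
     (\<forall>i<k. \<forall>x\<in>D i. x \<in> N \<or> (\<exists>y\<in>D i. {x, y} \<in> E \<and> d y < d x))"

lemma branch_structure_branching:
  assumes "branch_structure V E r (nb F r) k D d" "finite V" "r \<in> V" "E \<subseteq> F" "F \<subseteq> [V]\<^bsup>2\<^esup>"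
  shows "branching V F r k D d"
proof
  fix i x assume "i < k" "x \<in> D i"
  then show "x \<in> nb F r \<or> (\<exists>y \<in> D i. y \<in> nb F x \<and> d y < d x)"
    using assms(1,4) unfolding branch_structure_def nb_iff by (metis subsetD)
qed (use assms in \<open>auto simp: branch_structure_def\<close>)

text \<open>The pieces \<open>insert x (Q x)\<close> are numbered and dealt out modulo
  \<open>k\<close>, so all of \<open>N\<close> is covered and, as \<open>k \<le> card N\<close>, no
  index stays empty. Empty \<open>Q x\<close> are allowed for the dense case.\<close>

lemma branch_structure_exists:
  assumes N: "N \<subseteq> V - {r}" "finite N" "1 \<le> k" "k \<le> card N"
    and Q: "\<And>x. x \<in> N \<Longrightarrow> Q x \<subseteq> V - {r} - N" "disjoint_family_on Q N"
    and link: "\<And>x. x \<in> N \<Longrightarrow> Q x \<noteq> {} \<Longrightarrow> finite (Q x) \<and> linked E (Q x) \<and> (\<exists>y\<in>Q x. {x, y} \<in> E)"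
  shows "\<exists>D d. branch_structure V E r N k D d \<and> (\<Union>i<k. D i) = N \<union> (\<Union>x\<in>N. Q x) \<and>
    (\<forall>i<k. \<exists>x\<in>N. insert x (Q x) \<subseteq> D i)"
proof -
  obtain b where b: "bij_betw b N {..<card N}" using ex_bij_betw_finite_nat[OF N(2)] by (auto simp: atLeast0LessThan)
  define c where "c = (\<lambda>x. b x mod k)"
  have c: "c x < k" for x using N by (simp add: c_def)
  have csurj: "\<exists>x\<in>N. c x = i" if "i < k" for i
  proof -
    have "i \<in> b ` N" using b that N by (auto simp: bij_betw_def)
    then obtain x where "x \<in> N" "b x = i" by blast
    then show ?thesis using that by (intro bexI[of _ x]) (auto simp: c_def)
  qed
  define D where "D = (\<lambda>i. \<Union>x\<in>{x \<in> N. c x = i}. insert x (Q x))"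
  have "\<exists>d :: 'a \<Rightarrow> nat. \<forall>z\<in>Q x. {z, x} \<in> E \<or> (\<exists>y\<in>Q x. {z, y} \<in> E \<and> d y < d z)" if x: "x \<in> N" for x
  proof (cases "Q x = {}")
    case False
    then obtain y where y: "y \<in> Q x" "{x, y} \<in> E" "finite (Q x)" "linked E (Q x)" using link[OF x] by blast
    then obtain d :: "'a \<Rightarrow> nat" where "\<forall>z\<in>Q x - {y}. \<exists>w\<in>Q x. {z, w} \<in> E \<and> d w < d z"
      using linked_depth by metis
    then show ?thesis using y by (metis DiffI insert_commute singletonD)
  qed simp
  then obtain h where h: "\<And>x z. x \<in> N \<Longrightarrow> z \<in> Q x \<Longrightarrow>
      {z, x} \<in> E \<or> (\<exists>y\<in>Q x. {z, y} \<in> E \<and> h x y < (h x z :: nat))"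
    by metis
  \<comment> \<open>\<open>Suc\<close> puts a segment above its vertex of \<open>N\<close>, so that
    the step from the one to the other descends too.\<close>
  define d where "d = (\<lambda>z. if z \<in> N then 0 else Suc (h (THE x. x \<in> N \<and> z \<in> Q x) z))"
  have owner: "x = y" if "x \<in> N" "y \<in> N" "z \<in> Q x" "z \<in> Q y" for x y z
    using Q(2) that unfolding disjoint_family_on_def by blast
  have d_Q: "d z = Suc (h x z)" if "x \<in> N" "z \<in> Q x" for x z
  proof -
    have "(THE x. x \<in> N \<and> z \<in> Q x) = x" using that owner by (intro the_equality) auto
    moreover have "z \<notin> N" using Q(1)[OF that(1)] that by blast
    ultimately show ?thesis by (simp add: d_def)
  qed
  have cover: "(\<Union>i<k. D i) = N \<union> (\<Union>x\<in>N. Q x)" using c by (auto simp: D_def)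
  have big: "\<exists>x\<in>N. insert x (Q x) \<subseteq> D i" if "i < k" for i using csurj[OF that] by (auto simp: D_def)
  have desc: "x \<in> N \<or> (\<exists>y\<in>D i. {x, y} \<in> E \<and> d y < d x)" if x: "i < k" "x \<in> D i" for i x
  proof (cases "x \<in> N")
    case False
    then obtain w where w: "w \<in> N" "c w = i" "x \<in> Q w" using x by (auto simp: D_def)
    from h[OF w(1,3)] show ?thesis
    proof
      assume "{x, w} \<in> E"
      moreover have "w \<in> D i" "d w < d x" using w d_Q[OF w(1,3)] by (auto simp: D_def d_def)
      ultimately show ?thesis by blast
    next
      assume "\<exists>y\<in>Q w. {x, y} \<in> E \<and> h w y < h w x"
      then obtain y where y: "y \<in> Q w" "{x, y} \<in> E" "h w y < h w x" by blast
      moreover have "y \<in> D i" "d y < d x" using w y d_Q[OF w(1)] by (auto simp: D_def)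
      ultimately show ?thesis by blast
    qed
  qed simp
  have "disjoint_family_on D {..<k}"
    unfolding disjoint_family_on_def
  proof (intro ballI impI)
    fix i j :: nat assume "i \<noteq> j"
    show "D i \<inter> D j = {}"
    proof (rule ccontr)
      assume "D i \<inter> D j \<noteq> {}"
      then obtain z x y where "x \<in> N" "c x = i" "y \<in> N" "c y = j" "z \<in> insert x (Q x)" "z \<in> insert y (Q y)"
        by (auto simp: D_def)
      moreover from this have "x = y" using Q(1)[of x] Q(1)[of y] owner[of x y z] by auto
      ultimately show False using \<open>i \<noteq> j\<close> by simp
    qed
  qed
  moreover have "D i \<subseteq> V - {r}" for i using N(1) Q(1) by (force simp: D_def)
  moreover have "D i \<inter> N \<noteq> {}" if "i < k" for i using big[OF that] by blast
  moreover have "N \<subseteq> (\<Union>i<k. D i)" using cover by blast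
  ultimately have "branch_structure V E r N k D d" using desc unfolding branch_structure_def by blast
  then show ?thesis using cover big by blast
qed

section \<open>Exposing a random set in three rounds\<close>

lemma prob_bind_le:
  assumes "\<And>x. x \<in> set_pmf M \<Longrightarrow> measure_pmf.prob (f x) S \<le> \<beta>"
  shows "measure_pmf.prob (bind_pmf M f) S \<le> \<beta>"
proof -
  obtain x where "x \<in> set_pmf M" using set_pmf_not_empty by fast
  then have \<beta>: "0 \<le> \<beta>" using assms[of x] measure_nonneg[of "measure_pmf (f x)" S] by linarith
  have "emeasure (measure_pmf (bind_pmf M f)) S = (\<integral>\<^sup>+x. emeasure (measure_pmf (f x)) S \<partial>measure_pmf M)"
    by simp
  also have "\<dots> \<le> (\<integral>\<^sup>+x. ennreal \<beta> \<partial>measure_pmf M)"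
    using assms by (intro nn_integral_mono_AE)
      (auto simp: AE_measure_pmf_iff measure_pmf.emeasure_eq_measure ennreal_leI)
  also have "\<dots> = ennreal \<beta>" by simp
  finally show ?thesis using \<beta> by (simp add: measure_pmf.emeasure_eq_measure)
qed

lemma prob_le_on_support:
  assumes "\<And>x. x \<in> set_pmf M \<Longrightarrow> x \<in> S \<Longrightarrow> x \<in> S'" "measure_pmf.prob M S' \<le> \<beta>"
  shows "measure_pmf.prob M S \<le> \<beta>"
proof -
  have "measure_pmf.prob M S = measure_pmf.prob M (S \<inter> set_pmf M)" by (simp add: measure_Int_set_pmf)
  also have "\<dots> \<le> measure_pmf.prob M S'" using assms(1) by (intro measure_pmf.finite_measure_mono) auto
  finally show ?thesis using assms(2) by linarith
qed

lemma prob_exists_le: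
  assumes "finite A" "\<And>a. a \<in> A \<Longrightarrow> measure_pmf.prob M {x. P a x} \<le> \<beta>"
  shows "measure_pmf.prob M {x. \<exists>a\<in>A. P a x} \<le> real (card A) * \<beta>"
proof -
  have "{x. \<exists>a\<in>A. P a x} = (\<Union>a\<in>A. {x. P a x})" by auto
  then have "measure_pmf.prob M {x. \<exists>a\<in>A. P a x} \<le> (\<Sum>a\<in>A. measure_pmf.prob M {x. P a x})"
    using assms(1) measure_pmf.finite_measure_subadditive_finite[of A "\<lambda>a. {x. P a x}" M] by simp
  also have "\<dots> \<le> (\<Sum>a\<in>A. \<beta>)" using assms(2) by (intro sum_mono)
  finally show ?thesis by simp
qed

text \<open>Conditioning: \<open>H\<close> is the revealed part outside \<open>B\<close>, and a
  bound uniform in \<open>H\<close> holds overall.\<close>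

lemma random_subset_condition:
  assumes "finite I" "B \<subseteq> I" "\<And>H. H \<subseteq> I - B \<Longrightarrow> measure_pmf.prob (random_subset B q) {Y. P (H \<union> Y)} \<le> \<beta>"
  shows "measure_pmf.prob (random_subset I q) {Y. P Y} \<le> \<beta>"
proof -
  have "random_subset I q = random_subset ((I - B) \<union> B) q" using assms(2) by (simp add: Un_absorb2)
  also have "\<dots> = map_pmf (\<lambda>(X, Y). X \<union> Y) (pair_pmf (random_subset (I - B) q) (random_subset B q))"
    using assms(1,2) finite_subset by (intro random_subset_Un) auto
  also have "\<dots> = bind_pmf (random_subset (I - B) q) (\<lambda>H. map_pmf (\<lambda>Y. H \<union> Y) (random_subset B q))"
    by (simp add: pair_pmf_def map_pmf_def bind_assoc_pmf bind_return_pmf)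
  finally have eq: "random_subset I q = \<dots>" .
  show ?thesis
    unfolding eq
  proof (rule prob_bind_le)
    fix H assume "H \<in> set_pmf (random_subset (I - B) q)"
    then have "H \<subseteq> I - B" using set_pmf_random_subset by blast
    from assms(3)[OF this]
    show "measure_pmf.prob (map_pmf (\<lambda>Y. H \<union> Y) (random_subset B q)) {Y. P Y} \<le> \<beta>"
      by (simp add: vimage_def)
  qed
qed

definition rounds :: "'a set \<Rightarrow> real \<Rightarrow> ('a set \<times> 'a set \<times> 'a set) pmf" where
  "rounds I q = bind_pmf (random_subset I q) (\<lambda>X. bind_pmf (random_subset I q) (\<lambda>Y.
     bind_pmf (random_subset I q) (\<lambda>Z. return_pmf (X, Y, Z))))"

lemma set_pmf_rounds: "(X, Y, Z) \<in> set_pmf (rounds I q) \<Longrightarrow> X \<subseteq> I \<and> Y \<subseteq> I \<and> Z \<subseteq> I"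
  using set_pmf_random_subset[of I q] by (auto simp: rounds_def)

lemma rounds_union:
  assumes "finite I" "0 \<le> q" "q \<le> 1" "(1 - q) ^ 3 = 1 - p"
  shows "map_pmf (\<lambda>(X, Y, Z). X \<union> Y \<union> Z) (rounds I q) = random_subset I p"
proof -
  have "0 \<le> (1 - q) ^ 2" "(1 - q) ^ 2 \<le> 1" using assms by (auto intro: power_le_one)
  then have pq: "0 \<le> q + q - q * q" "q + q - q * q \<le> 1" by (auto simp: power2_eq_square algebra_simps)
  have "map_pmf (\<lambda>(X, Y, Z). X \<union> Y \<union> Z) (rounds I q) = bind_pmf (random_subset I q) (\<lambda>X.
      bind_pmf (bind_pmf (random_subset I q) (\<lambda>Y. bind_pmf (random_subset I q) (\<lambda>Z. return_pmf (Y \<union> Z))))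
        (\<lambda>W. return_pmf (X \<union> W)))"
    by (simp add: rounds_def map_bind_pmf bind_assoc_pmf bind_return_pmf Un_assoc)
  also have "\<dots> = random_subset I (q + (q + q - q * q) - q * (q + q - q * q))"
    unfolding random_subset_superpose[OF assms(1-3) assms(2,3)]
    using pq assms by (intro random_subset_superpose) auto
  also have "q + (q + q - q * q) - q * (q + q - q * q) = p"
    using assms(4) by (simp add: power3_eq_cube algebra_simps)
  finally show ?thesis .
qed

lemma rounds_le_fst:
  assumes "measure_pmf.prob (random_subset I q) {X. P X} \<le> \<beta>"
  shows "measure_pmf.prob (rounds I q) {(X, Y, Z). P X} \<le> \<beta>"
proof -
  have "map_pmf fst (rounds I q) = random_subset I q"
    by (simp add: rounds_def map_bind_pmf bind_return_pmf')
  moreover have "{(X, Y, Z). P X} = fst -` {X. P X}" by auto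
  ultimately show ?thesis using assms by (metis measure_map_pmf)
qed

text \<open>Independent draws commute, so the second round can be drawn last. This is needed as the
  neighbourhood of \<open>r\<close> also involves the third round.\<close>

lemma rounds_le_snd:
  assumes "\<And>X Z. X \<subseteq> I \<Longrightarrow> Z \<subseteq> I \<Longrightarrow> measure_pmf.prob (random_subset I q) {Y. P X Y Z} \<le> \<beta>"
  shows "measure_pmf.prob (rounds I q) {(X, Y, Z). P X Y Z} \<le> \<beta>"
proof -
  have eq: "rounds I q = bind_pmf (random_subset I q) (\<lambda>X. bind_pmf (random_subset I q) (\<lambda>Z.
      map_pmf (\<lambda>Y. (X, Y, Z)) (random_subset I q)))"
    unfolding rounds_def map_pmf_def by (rule bind_pmf_cong[OF refl]) (rule bind_commute_pmf)
  show ?thesis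
    unfolding eq
  proof (intro prob_bind_le)
    fix X Z assume "X \<in> set_pmf (random_subset I q)" "Z \<in> set_pmf (random_subset I q)"
    then have "X \<subseteq> I" "Z \<subseteq> I" using set_pmf_random_subset by blast+
    from assms[OF this]
    show "measure_pmf.prob (map_pmf (\<lambda>Y. (X, Y, Z)) (random_subset I q)) {(X, Y, Z). P X Y Z} \<le> \<beta>"
      by (simp add: vimage_def)
  qed
qed

lemma rounds_le_trd:
  assumes "\<And>X Y. X \<subseteq> I \<Longrightarrow> Y \<subseteq> I \<Longrightarrow> measure_pmf.prob (random_subset I q) {Z. P X Y Z} \<le> \<beta>"
  shows "measure_pmf.prob (rounds I q) {(X, Y, Z). P X Y Z} \<le> \<beta>"
proof -
  have eq: "rounds I q = bind_pmf (random_subset I q) (\<lambda>X. bind_pmf (random_subset I q) (\<lambda>Y.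
      map_pmf (\<lambda>Z. (X, Y, Z)) (random_subset I q)))"
    unfolding rounds_def map_pmf_def ..
  show ?thesis
    unfolding eq
  proof (intro prob_bind_le)
    fix X Y assume "X \<in> set_pmf (random_subset I q)" "Y \<in> set_pmf (random_subset I q)"
    then have "X \<subseteq> I" "Y \<subseteq> I" using set_pmf_random_subset by blast+
    from assms[OF this]
    show "measure_pmf.prob (map_pmf (\<lambda>Z. (X, Y, Z)) (random_subset I q)) {(X, Y, Z). P X Y Z} \<le> \<beta>"
      by (simp add: vimage_def)
  qed
qed

section \<open>Edges between two vertex sets\<close>

lemma nb_Un: "nb (E \<union> F) v = nb E v \<union> nb F v"
  by (auto simp: nb_def)

lemma nb_avoid: "(\<And>e. e \<in> E \<Longrightarrow> v \<notin> e) \<Longrightarrow> nb E v = {}"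
  by (auto simp: nb_def)

definition edges_between :: "'a set \<Rightarrow> 'a set \<Rightarrow> 'a set set" where
  "edges_between A B = (\<lambda>(x, y). {x, y}) ` (A \<times> B)"

lemma edges_betweenE:
  assumes "e \<in> edges_between A B"
  obtains x y where "x \<in> A" "y \<in> B" "e = {x, y}"
  using assms by (auto simp: edges_between_def)

lemma edges_between_subset:
  "A \<subseteq> V \<Longrightarrow> B \<subseteq> V \<Longrightarrow> A \<inter> B = {} \<Longrightarrow> edges_between A B \<subseteq> [V]\<^bsup>2\<^esup>"
  by (auto simp: edges_between_def)

lemma card_edges_between:
  assumes "A \<inter> B = {}"
  shows "card (edges_between A B) = card A * card B"
proof -
  have "inj_on (\<lambda>(x, y). {x, y}) (A \<times> B)"
    using assms by (auto simp: inj_on_def doubleton_eq_iff)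
  then show ?thesis by (simp add: edges_between_def card_image card_cartesian_product)
qed

lemma edges_between_Int:
  "E \<inter> edges_between {v} B = (\<lambda>y. {v, y}) ` (nb E v \<inter> B)"
  by (auto simp: edges_between_def nb_def)

lemma card_Int_star: "card (E \<inter> edges_between {v} B) = card (nb E v \<inter> B)"
  unfolding edges_between_Int by (intro card_image) (auto simp: inj_on_def doubleton_eq_iff)

lemma card_star_Diff: "card (edges_between {v} B - E) = card (B - nb E v)"
proof -
  have "edges_between {v} B - E = (\<lambda>y. {v, y}) ` (B - nb E v)"
    by (auto simp: edges_between_def nb_def)
  then show ?thesis by (simp add: card_image inj_on_def doubleton_eq_iff)
qed

text \<open>An edge has only one end in \<open>R\<close>, which is \<open>x\<close>, and its other
  end determines \<open>i\<close>. This provides the disjointness required by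
  \<open>random_matching\<close>.\<close>

lemma edges_between_singleton_disjoint:
  assumes "x \<in> R" "x' \<in> R" "S i \<inter> R = {}" "S i' \<inter> R = {}" "i \<noteq> i' \<Longrightarrow> S i \<inter> S i' = {}"
    and "edges_between {x} (S i) \<inter> edges_between {x'} (S i') \<noteq> {}"
  shows "i = i' \<and> x = x'"
proof -
  obtain y y' where "y \<in> S i" "y' \<in> S i'" "{x, y} = {x', y'}"
    using assms(6) by (auto simp: edges_between_def)
  then show ?thesis using assms(1-5) by (auto simp: doubleton_eq_iff)
qed

section \<open>Degrees and segments in the random graph\<close>

text \<open>The requirements of large \<open>n\<close> are assumed here for a fixed \<open>n\<close>
  and verified asymptotically at the end. \<open>dense_tail\<close> is the union bound over the
  roots for too few non-neighbours.\<close>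

locale random_rounds =
  fixes n :: nat and p :: real
  assumes n_large: "10000 \<le> n"
    and p_lower: "10000000 * ln (real n) \<le> real n * p"
    and p_upper: "p \<le> 0.99"
    and dense_tail: "real n * (2 powr (real n / 250) * exp (- (real n - 1) / 200)) \<le> 1 / real n"
begin

abbreviation V :: "nat set" where "V \<equiv> {..<n}"

abbreviation I :: "nat set set" where "I \<equiv> [{..<n}]\<^bsup>2\<^esup>"

text \<open>
  \<open>q\<close> is the density of each of the three rounds, whose union has density \<open>p\<close>; \<open>s\<close> is the size of a
  segment, chosen so that \<open>q * s\<close> is bounded below by a constant while \<open>10 * L - 1\<close> disjoint segments
  still fit into the graph if \<open>p \<le> 1 / 40\<close>.
\<close>

definition L :: real where "L = real n * p"

definition q :: real where "q = 1 - root 3 (1 - p)"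

definition s :: nat where "s = nat \<lceil>1 / (40 * p)\<rceil>"

text \<open>With \<open>K * s \<le> n / 2\<close> and \<open>3 * m \<le> n / 4\<close>, the greedy
  choice of segments does not run out of vertices.\<close>

definition m :: nat where "m = n div 12"

definition K :: nat where "K = n div (2 * s)"

lemma finite_I: "finite I"
  by (simp add: finite_imp_finite_nsets)

lemma ln_n: "1 \<le> ln (real n)"
proof -
  have "(3::real) \<le> real n" using n_large by simp
  with exp_le have "exp 1 \<le> real n" by (rule order_trans)
  then show ?thesis using n_large by (simp add: ln_ge_iff)
qed

lemma L_large: "10000000 \<le> L"
  using p_lower ln_n unfolding L_def by linarith

lemma p_pos: "0 < p"
proof -
  have "0 < real n * p" using L_large unfolding L_def by linarith
  then show ?thesis by (simp add: zero_less_mult_iff)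
qed

lemma q_cube: "(1 - q) ^ 3 = 1 - p"
  by (simp add: q_def odd_real_root_pow)

lemma q_bounds: "0 \<le> q" "q \<le> 1"
  using p_pos p_upper by (auto simp: q_def)

lemma q_ge: "p / 3 \<le> q"
proof -
  have "0 \<le> q\<^sup>2 * (3 - q)" using q_bounds by simp
  then show ?thesis using q_cube by (simp add: power3_eq_cube power2_eq_square algebra_simps)
qed

lemma s_ge: "1 / (40 * p) \<le> real s"
  unfolding s_def by (rule real_nat_ceiling_ge)

lemma s_le: "real s \<le> 1 / (40 * p) + 1"
proof -
  have "0 \<le> 1 / (40 * p)" using p_pos by simp
  then show ?thesis unfolding s_def using ceiling_correct[of "1 / (40 * p)"] by linarith
qed

lemma s_pos: "1 \<le> s"
proof -
  have "0 < 1 / (40 * p)" using p_pos by simp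
  then have "0 < real s" using s_ge by linarith
  then show ?thesis by simp
qed

lemma qs_ge: "1 / 120 \<le> q * real s"
proof -
  have "1 / 120 = p / 3 * (1 / (40 * p))" using p_pos by simp
  also have "\<dots> \<le> q * real s" using q_ge s_ge p_pos q_bounds by (intro mult_mono) auto
  finally show ?thesis .
qed

text \<open>This is where the constant 10000000 comes from. The most demanding use has
  \<open>c = 1 / 960000\<close> and \<open>j = 8\<close>: five powers of \<open>n\<close> for the
  union bound over triples and three for the factor in \<open>random_matching\<close>.\<close>

lemma exp_tail:
  assumes "real j \<le> c * 10000000" "0 \<le> c"
  shows "exp (- (c * L)) \<le> 1 / real n ^ j"
proof -
  have "real j * ln (real n) \<le> c * 10000000 * ln (real n)" using assms ln_n by (intro mult_right_mono) auto
  also have "\<dots> = c * (10000000 * ln (real n))" by simp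
  also have "\<dots> \<le> c * L" using p_lower assms(2) by (intro mult_left_mono) (auto simp: L_def)
  finally have "exp (- (c * L)) \<le> exp (- (real j * ln (real n)))" by simp
  also have "\<dots> = 1 / real n ^ j" using n_large by (simp add: exp_minus exp_of_nat_mult divide_inverse)
  finally show ?thesis .
qed

lemma star_edges: "v \<in> V \<Longrightarrow> B \<subseteq> V - {v} \<Longrightarrow> edges_between {v} B \<subseteq> I"
  by (rule edges_between_subset) auto

text \<open>Both alternatives keep the branches from filling the graph: in the dense case they cover
  just the neighbourhood of \<open>r\<close>, in the sparse case its size bounds the number of
  segments used.\<close>

definition degree_failure :: "nat set set \<Rightarrow> bool" where
  "degree_failure E \<longleftrightarrow> (\<exists>r\<in>V. if 1 / 40 < p then real (card (V - nb E r)) \<le> real n / 250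
     else 3 * L \<le> real (card (nb E r)))"

lemma prob_degree_failure: "measure_pmf.prob (random_subset I p) {E. degree_failure E} \<le> 1 / real n"
proof (cases "1 / 40 < p")
  case True
  \<comment> \<open>At least \<open>(n - 1) / 100\<close> non-neighbours are expected as
    \<open>1 - p \<ge> 1 / 100\<close>, and half of this is the exponent of the tail bound.\<close>
  have each: "measure_pmf.prob (random_subset I p) {E. real (card (V - nb E r)) \<le> real n / 250} \<le>
      2 powr (real n / 250) * exp (- (real n - 1) / 200)" if r: "r \<in> V" for r
  proof -
    let ?T = "edges_between {r} (V - {r})"
    have T: "?T \<subseteq> I" using star_edges[OF r] by blast
    have cT: "real (card ?T) = real n - 1" using r by (simp add: card_edges_between of_nat_diff)
    have "measure_pmf.prob (random_subset I p) {E. real (card (?T - E)) \<le> real n / 250} \<le>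
        2 powr (real n / 250) * exp (- (1 - p) * real (card ?T) / 2)"
      using p_pos p_upper by (intro random_subset_complement_lower_tail finite_I T) auto
    also have "\<dots> \<le> 2 powr (real n / 250) * exp (- (real n - 1) / 200)"
    proof -
      have "1 / 100 * (real n - 1) \<le> (1 - p) * (real n - 1)"
        using p_upper n_large by (intro mult_right_mono) auto
      moreover have "- (1 - p) * (real n - 1) / 2 = - ((1 - p) * (real n - 1)) / 2"
        by (simp add: algebra_simps)
      ultimately have "- (1 - p) * (real n - 1) / 2 \<le> - (real n - 1) / 200" by linarith
      then show ?thesis unfolding cT by (intro mult_left_mono) auto
    qed
    finally have *: "measure_pmf.prob (random_subset I p) {E. real (card (?T - E)) \<le> real n / 250} \<le>
        2 powr (real n / 250) * exp (- (real n - 1) / 200)" .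
    show ?thesis
    proof (rule prob_le_on_support[OF _ *])
      fix E assume "E \<in> {E. real (card (V - nb E r)) \<le> real n / 250}"
      moreover have "card (?T - E) \<le> card (V - nb E r)"
        unfolding card_star_Diff by (intro card_mono) auto
      ultimately show "E \<in> {E. real (card (?T - E)) \<le> real n / 250}" by simp
    qed
  qed
  have "measure_pmf.prob (random_subset I p) {E. \<exists>r\<in>V. real (card (V - nb E r)) \<le> real n / 250} \<le>
      real (card V) * (2 powr (real n / 250) * exp (- (real n - 1) / 200))"
    using each by (intro prob_exists_le) auto
  then show ?thesis using dense_tail True by (simp add: degree_failure_def)
next
  case False
  have each: "measure_pmf.prob (random_subset I p) {E. 3 * L \<le> real (card (nb E r))} \<le> 1 / real n ^ 2"
    if r: "r \<in> V" for r
  proof -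
    let ?T = "edges_between {r} (V - {r})"
    have T: "?T \<subseteq> I" using star_edges[OF r] by blast
    have cT: "card ?T = n - 1" using r by (simp add: card_edges_between)
    have "measure_pmf.prob (random_subset I p) {E. 3 * L \<le> real (card (E \<inter> ?T))} \<le>
        2 powr (- (3 * L)) * exp (p * real (card ?T))"
      using p_pos p_upper by (intro random_subset_upper_tail finite_I T) auto
    also have "\<dots> \<le> exp (- (2 * L)) * exp L"
    proof (intro mult_mono)
      have "2 * L \<le> 3 * L * ln 2" using ln2_ge_two_thirds L_large by (simp add: field_simps)
      then show "2 powr (- (3 * L)) \<le> exp (- (2 * L))" by (simp add: powr_def)
      have "p * real (n - 1) \<le> p * real n" using p_pos by (intro mult_left_mono) auto
      then show "exp (p * real (card ?T)) \<le> exp L" unfolding cT by (simp add: L_def mult.commute)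
    qed auto
    also have "\<dots> = exp (- (1 * L))" by (simp add: exp_add[symmetric])
    also have "\<dots> \<le> 1 / real n ^ 2" by (rule exp_tail) auto
    finally have *: "measure_pmf.prob (random_subset I p) {E. 3 * L \<le> real (card (E \<inter> ?T))} \<le> 1 / real n ^ 2" .
    show ?thesis
    proof (rule prob_le_on_support[OF _ *])
      fix E assume "E \<in> set_pmf (random_subset I p)" and E: "E \<in> {E. 3 * L \<le> real (card (nb E r))}"
      then have "nb E r \<inter> (V - {r}) = nb E r"
        using nb_subset[of E V r] set_pmf_random_subset by blast
      then show "E \<in> {E. 3 * L \<le> real (card (E \<inter> ?T))}" using E by (simp add: card_Int_star)
    qed
  qed
  have "measure_pmf.prob (random_subset I p) {E. \<exists>r\<in>V. 3 * L \<le> real (card (nb E r))} \<le>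
      real (card V) * (1 / real n ^ 2)"
    using each by (intro prob_exists_le) auto
  then show ?thesis using False n_large by (simp add: degree_failure_def power2_eq_square)
qed

section \<open>Expansion of the first round and its segments\<close>

definition expanding :: "nat set set \<Rightarrow> bool" where
  "expanding X \<longleftrightarrow> (\<forall>A B. A \<subseteq> V \<longrightarrow> B \<subseteq> V \<longrightarrow> A \<inter> B = {} \<longrightarrow> m \<le> card A \<longrightarrow> m \<le> card B \<longrightarrow>
     (\<exists>x\<in>A. \<exists>y\<in>B. {x, y} \<in> X))"

lemma m_ge: "real n / 16 \<le> real m"
proof -
  have "n < 12 + 12 * m" unfolding m_def by (rule dividend_less_times_div) simp
  then have "real n < 12 + 12 * real m" by linarith
  then show ?thesis using n_large by linarith
qed

text \<open>At most \<open>4 ^ n\<close> pairs of sets stand against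
  \<open>q * m ^ 2 \<ge> L * n / 768 \<ge> 3 * n\<close> expected edges for each pair.\<close>

lemma prob_not_expanding: "measure_pmf.prob (random_subset I q) {X. \<not> expanding X} \<le> 1 / real n"
proof -
  define P where "P = {(A, B). A \<subseteq> V \<and> B \<subseteq> V \<and> A \<inter> B = {} \<and> m \<le> card A \<and> m \<le> card B}"
  have Psub: "P \<subseteq> Pow V \<times> Pow V" by (auto simp: P_def)
  then have fP: "finite P" by (rule finite_subset) simp
  have "card P \<le> card (Pow V \<times> Pow V)" by (intro card_mono Psub) simp
  also have "\<dots> = 2 ^ n * 2 ^ n" by (simp add: card_cartesian_product card_Pow)
  finally have "real (card P) \<le> real (2 ^ n * 2 ^ n)" by (rule of_nat_mono)
  also have "real (2 ^ n * 2 ^ n) = 2 ^ n * 2 ^ n" by simp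
  also have "\<dots> \<le> exp 1 ^ n * exp 1 ^ n"
    using exp_ge_add_one_self[of 1] by (intro mult_mono power_mono) auto
  also have "\<dots> = exp (2 * real n)" by (simp add: exp_of_nat_mult[symmetric] exp_add[symmetric])
  finally have cP: "real (card P) \<le> exp (2 * real n)" .
  have each: "measure_pmf.prob (random_subset I q) {X. X \<inter> edges_between (fst a) (snd a) = {}} \<le> exp (- 3 * real n)"
    if "a \<in> P" for a
  proof -
    obtain A B where a: "a = (A, B)" by (cases a)
    have AB: "A \<subseteq> V" "B \<subseteq> V" "A \<inter> B = {}" "m \<le> card A" "m \<le> card B" using that by (auto simp: P_def a)
    have "measure_pmf.prob (random_subset I q) {X. X \<inter> edges_between A B = {}} \<le>
        exp (- q * real (card (edges_between A B)))"
      using AB q_bounds by (intro random_subset_avoid finite_I edges_between_subset)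
    also have "\<dots> \<le> exp (- 3 * real n)"
    proof -
      have "2304 * real n \<le> L * real n" using L_large by (intro mult_right_mono) auto
      then have "3 * real n \<le> L * real n / 768" by simp
      also have "\<dots> = p / 3 * (real n / 16 * (real n / 16))" by (simp add: L_def)
      also have "\<dots> \<le> q * (real m * real m)"
        using q_ge p_pos q_bounds m_ge by (intro mult_mono) auto
      also have "\<dots> \<le> q * (real (card A) * real (card B))"
        using AB q_bounds by (intro mult_left_mono mult_mono) auto
      finally show ?thesis using AB by (simp add: card_edges_between)
    qed
    finally show ?thesis by (simp add: a)
  qed
  have "measure_pmf.prob (random_subset I q) {X. \<exists>a\<in>P. X \<inter> edges_between (fst a) (snd a) = {}} \<le>
      real (card P) * exp (- 3 * real n)"
    using each by (intro prob_exists_le fP)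
  also have "\<dots> \<le> exp (2 * real n) * exp (- 3 * real n)" using cP by (intro mult_right_mono) auto
  also have "\<dots> = exp (- real n)" by (simp add: exp_add[symmetric])
  also have "\<dots> \<le> 1 / real n"
  proof -
    have "real n \<le> exp (real n)" using exp_ge_add_one_self[of "real n"] by linarith
    then show ?thesis using n_large by (simp add: exp_minus field_simps)
  qed
  finally have *: "measure_pmf.prob (random_subset I q)
      {X. \<exists>a\<in>P. X \<inter> edges_between (fst a) (snd a) = {}} \<le> 1 / real n" .
  show ?thesis
  proof (rule prob_le_on_support[OF _ *])
    fix X assume "X \<in> {X. \<not> expanding X}"
    then obtain A B where AB: "A \<subseteq> V" "B \<subseteq> V" "A \<inter> B = {}" "m \<le> card A" "m \<le> card B"
      and none: "\<forall>x\<in>A. \<forall>y\<in>B. {x, y} \<notin> X"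
      by (auto simp: expanding_def)
    have "X \<inter> edges_between A B = {}" using none by (auto elim: edges_betweenE)
    moreover have "(A, B) \<in> P" using AB by (simp add: P_def)
    ultimately show "X \<in> {X. \<exists>a\<in>P. X \<inter> edges_between (fst a) (snd a) = {}}" by force
  qed
qed

lemma s_le_sparse: "p \<le> 1 / 40 \<Longrightarrow> real s \<le> 1 / (20 * p)"
  using s_le p_pos by (simp add: field_simps)

lemma K_bounds: "K * s + 3 * m \<le> n" "p \<le> 1 / 40 \<Longrightarrow> 10 * L \<le> real K + 1" "K \<le> n"
proof -
  have "K * (2 * s) \<le> n" unfolding K_def by simp
  moreover have "12 * m \<le> n" by (simp add: m_def)
  moreover have "K * (2 * s) = 2 * (K * s)" by simp
  ultimately show "K * s + 3 * m \<le> n" by linarith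
  show "K \<le> n" by (simp add: K_def)
  assume sparse: "p \<le> 1 / 40"
  have "n < 2 * s + 2 * s * K" using s_pos unfolding K_def by (intro dividend_less_times_div) auto
  then have "real n < real (2 * s + 2 * s * K)" by (rule of_nat_less_iff[THEN iffD2])
  then have "real n < 2 * real s * (real K + 1)" by (simp add: algebra_simps)
  also have "\<dots> \<le> 2 * (1 / (20 * p)) * (real K + 1)"
    using s_le_sparse[OF sparse] by (intro mult_right_mono mult_left_mono) auto
  finally show "10 * L \<le> real K + 1" using p_pos by (simp add: L_def field_simps)
qed

lemma s_le_m:
  assumes "p \<le> 1 / 40"
  shows "s \<le> m"
proof -
  have "1 / (40 * p) = real n / (40 * L)" using p_pos n_large by (simp add: L_def)
  also have "\<dots> \<le> real n / (40 * 10000000)" using L_large by (intro divide_left_mono) auto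
  finally have "real s \<le> real n / (40 * 10000000) + 1" using s_le by linarith
  then have "real s \<le> real m" using m_ge n_large by simp
  then show ?thesis by simp
qed

text \<open>The choice depends on the first round alone and is the same for all roots, so the second
  round is independent of it.\<close>

definition segments :: "nat set set \<Rightarrow> nat \<Rightarrow> nat set" where
  "segments X = (SOME Q. (\<forall>i<K. Q i \<subseteq> V \<and> card (Q i) = s \<and> linked X (Q i)) \<and> disjoint_family_on Q {..<K})"

lemma segments:
  assumes "p \<le> 1 / 40" "expanding X"
  shows "i < K \<Longrightarrow> segments X i \<subseteq> V" "i < K \<Longrightarrow> card (segments X i) = s"
    "i < K \<Longrightarrow> linked X (segments X i)" "disjoint_family_on (segments X) {..<K}"
proof -
  have "\<exists>Q. (\<forall>i<K. Q i \<subseteq> V \<and> card (Q i) = s \<and> linked X (Q i)) \<and> disjoint_family_on Q {..<K}"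
    using K_bounds(1) s_pos s_le_m[OF assms(1)] assms(2)
    by (intro linked_family_exists[of V K s m]) (auto simp: expanding_def)
  from someI_ex[OF this, folded segments_def]
  show "i < K \<Longrightarrow> segments X i \<subseteq> V" "i < K \<Longrightarrow> card (segments X i) = s"
    "i < K \<Longrightarrow> linked X (segments X i)" "disjoint_family_on (segments X) {..<K}"
    by auto
qed

definition free_segments :: "nat set set \<Rightarrow> nat set \<Rightarrow> nat \<Rightarrow> nat set" where
  "free_segments X N r = {j. j < K \<and> segments X j \<inter> insert r N = {}}"

text \<open>Disjoint segments that meet \<open>insert r N\<close> contain different elements of it,
  so fewer than \<open>3 * L + 1\<close> of at least \<open>10 * L - 1\<close> segments are
  lost.\<close>

lemma card_free_segments:
  assumes "p \<le> 1 / 40" "expanding X" "finite N" "real (card N) < 3 * L"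
  shows "3 * L \<le> real (card (free_segments X N r))"
proof -
  define B where "B = {j. j < K \<and> segments X j \<inter> insert r N \<noteq> {}}"
  have "\<forall>j\<in>B. \<exists>x. x \<in> segments X j \<inter> insert r N" by (auto simp: B_def)
  then obtain g where g: "\<And>j. j \<in> B \<Longrightarrow> g j \<in> segments X j \<inter> insert r N" by metis
  have "inj_on g B"
  proof (rule inj_onI)
    fix i j assume "i \<in> B" "j \<in> B" "g i = g j"
    then have "i < K" "j < K" "segments X i \<inter> segments X j \<noteq> {}"
      using g[of i] g[of j] by (auto simp: B_def)
    then show "i = j" using segments(4)[OF assms(1,2)] unfolding disjoint_family_on_def by blast
  qed
  then have "card B \<le> card (insert r N)" using g assms(3) by (intro card_inj_on_le[of g]) auto
  then have B: "card B \<le> card N + 1" using card_insert_le_m1[of "card N + 1" N r] by simp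
  have "{..<K} = free_segments X N r \<union> B" "free_segments X N r \<inter> B = {}" "finite B"
    "finite (free_segments X N r)"
    by (auto simp: free_segments_def B_def)
  then have "K = card (free_segments X N r) + card B" by (metis card_Un_disjoint card_lessThan)
  then show ?thesis using B K_bounds(2)[OF assms(1)] assms(4) L_large by linarith
qed

section \<open>Matching the neighbours of the root to segments\<close>

definition segment_matching :: "nat set set \<Rightarrow> nat set set \<Rightarrow> nat set \<Rightarrow> nat \<Rightarrow> bool" where
  "segment_matching X Y N r \<longleftrightarrow> (\<exists>f. inj_on f N \<and>
     (\<forall>x\<in>N. f x \<in> free_segments X N r \<and> Y \<inter> edges_between {x} (segments X (f x)) \<noteq> {}))"

lemma segment_matching_mono: "segment_matching X Y N r \<Longrightarrow> Y \<subseteq> Y' \<Longrightarrow> segment_matching X Y' N r"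
  unfolding segment_matching_def by blast

text \<open>Sparsity and expansion are part of the event, so that its probability is small for every
  fixed first round.\<close>

definition segment_failure :: "nat set set \<Rightarrow> nat set set \<Rightarrow> nat set set \<Rightarrow> bool" where
  "segment_failure X Y Z \<longleftrightarrow> p \<le> 1 / 40 \<and> expanding X \<and> (\<exists>r\<in>V. real (card (nb (X \<union> Y \<union> Z) r)) < 3 * L \<and>
     \<not> segment_matching X Y (nb (X \<union> Y \<union> Z) r) r)"

lemma cubic_tail:
  assumes "real k \<le> real n" "real j + 3 \<le> c * 10000000" "0 \<le> c" "c * L \<le> q * real s * real k / 2"
  shows "real k ^ 3 * exp (- q * real s * real k / 2) \<le> 1 / real n ^ j"
proof -
  have "real k ^ 3 * exp (- q * real s * real k / 2) \<le> real n ^ 3 * exp (- (c * L))"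
    using assms by (intro mult_mono power_mono) auto
  also have "\<dots> \<le> real n ^ 3 * (1 / real n ^ (j + 3))"
    using assms by (intro mult_left_mono exp_tail) auto
  also have "\<dots> = 1 / real n ^ j" using n_large by (simp add: power_add)
  finally show ?thesis .
qed

text \<open>Revealing the second-round edges at \<open>r\<close> fixes \<open>N\<close>. The edges
  from \<open>N\<close> to free segments avoid \<open>r\<close> and are still random.\<close>

lemma prob_segment_failure:
  "measure_pmf.prob (rounds I q) {(X, Y, Z). segment_failure X Y Z} \<le> 1 / real n"
proof (rule rounds_le_snd)
  fix X Z assume XZ: "X \<subseteq> I" "Z \<subseteq> I"
  show "measure_pmf.prob (random_subset I q) {Y. segment_failure X Y Z} \<le> 1 / real n"
  proof (cases "p \<le> 1 / 40 \<and> expanding X")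
    case False
    then have "{Y. segment_failure X Y Z} = {}" by (auto simp: segment_failure_def)
    then show ?thesis by simp
  next
    case True
    then have sparse: "p \<le> 1 / 40" and ex: "expanding X" by auto
    note seg = segments[OF sparse ex]
    have each: "measure_pmf.prob (random_subset I q) {Y. real (card (nb (X \<union> Y \<union> Z) r)) < 3 * L \<and>
        \<not> segment_matching X Y (nb (X \<union> Y \<union> Z) r) r} \<le> 1 / real n ^ 2" if r: "r \<in> V" for r
    proof (rule random_subset_condition[where B = "{e \<in> I. r \<notin> e}"])
      fix H assume H: "H \<subseteq> I - {e \<in> I. r \<notin> e}"
      define B where "B = {e \<in> I. r \<notin> e}"
      define N where "N = nb (X \<union> H \<union> Z) r"
      have N_V: "N \<subseteq> V - {r}" using nb_subset[of "X \<union> H \<union> Z" V r] XZ H by (auto simp: N_def)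
      then have fN: "finite N" by (rule finite_subset) simp
      have nbN: "nb (X \<union> (H \<union> Y) \<union> Z) r = N" if "Y \<subseteq> B" for Y
        using that nb_avoid[of Y r] by (auto simp: N_def nb_Un B_def)
      show "measure_pmf.prob (random_subset {e \<in> I. r \<notin> e} q) {Y. real (card (nb (X \<union> (H \<union> Y) \<union> Z) r)) < 3 * L \<and>
        \<not> segment_matching X (H \<union> Y) (nb (X \<union> (H \<union> Y) \<union> Z) r) r} \<le> 1 / real n ^ 2"
      proof (cases "real (card N) < 3 * L")
        case False
        show ?thesis unfolding B_def[symmetric]
          by (rule prob_le_on_support[where S' = "{}"])
            (use False nbN set_pmf_random_subset[of B q] in auto)
      next
        case small: True
        define R where "R = free_segments X N r"
        have fR: "finite R" by (simp add: R_def free_segments_def)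
        have cR: "3 * L \<le> real (card R)"
          unfolding R_def by (rule card_free_segments[OF sparse ex fN small])
        have "R \<subseteq> {..<K}" by (auto simp: R_def free_segments_def)
        then have "card R \<le> n" using K_bounds(3) card_mono[of "{..<K}" R] by simp
        have "measure_pmf.prob (random_subset B q) {Y. \<not> (\<exists>f. inj_on f N \<and>
            (\<forall>x\<in>N. f x \<in> R \<and> Y \<inter> edges_between {x} (segments X (f x)) \<noteq> {}))} \<le>
            real (card R) ^ 3 * exp (- q * real s * real (card R) / 2)"
        proof (rule random_matching)
          show "finite B" using finite_I by (simp add: B_def)
          show "card N \<le> card R" using cR small by linarith
        next
          fix x j assume x: "x \<in> N" and j: "j \<in> R"
          then have jK: "j < K" "segments X j \<inter> insert r N = {}" by (auto simp: R_def free_segments_def)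
          then have "edges_between {x} (segments X j) \<subseteq> I"
            using seg(1)[of j] x N_V by (intro star_edges) auto
          moreover have "r \<notin> e" if "e \<in> edges_between {x} (segments X j)" for e
            using that x N_V jK by (auto elim: edges_betweenE)
          moreover have "card (edges_between {x} (segments X j)) = s"
            using seg(2)[of j] jK x by (subst card_edges_between) auto
          ultimately show "edges_between {x} (segments X j) \<subseteq> B \<and> s \<le> card (edges_between {x} (segments X j))"
            by (auto simp: B_def)
        next
          fix x j x' j'
          assume "x \<in> N" "j \<in> R" "x' \<in> N" "j' \<in> R"
            "edges_between {x} (segments X j) \<inter> edges_between {x'} (segments X j') \<noteq> {}"
          moreover from this have "segments X j \<inter> N = {}" "segments X j' \<inter> N = {}"
            "j \<noteq> j' \<Longrightarrow> segments X j \<inter> segments X j' = {}"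
            using seg(4) by (auto simp: R_def free_segments_def disjoint_family_on_def)
          ultimately show "x = x' \<and> j = j'"
            using edges_between_singleton_disjoint[of x N x' "segments X" j j'] by blast
        qed (use q_bounds fN fR in auto)
        also have "\<dots> \<le> 1 / real n ^ 2"
        proof (rule cubic_tail)
          \<comment> \<open>From \<open>q * s \<ge> 1 / 120\<close> and
            \<open>card R \<ge> 3 * L\<close>.\<close>
          show "1 / 80 * L \<le> q * real s * real (card R) / 2"
            using mult_mono[OF qs_ge cR] q_bounds L_large by simp
        qed (use \<open>card R \<le> n\<close> in auto)
        finally have *: "measure_pmf.prob (random_subset B q) {Y. \<not> (\<exists>f. inj_on f N \<and>
            (\<forall>x\<in>N. f x \<in> R \<and> Y \<inter> edges_between {x} (segments X (f x)) \<noteq> {}))} \<le> 1 / real n ^ 2" .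
        show ?thesis unfolding B_def[symmetric]
        proof (rule prob_le_on_support[OF _ *])
          fix Y assume "Y \<in> set_pmf (random_subset B q)"
            and Y: "Y \<in> {Y. real (card (nb (X \<union> (H \<union> Y) \<union> Z) r)) < 3 * L \<and>
              \<not> segment_matching X (H \<union> Y) (nb (X \<union> (H \<union> Y) \<union> Z) r) r}"
          then have "Y \<subseteq> B" using set_pmf_random_subset by blast
          then have "\<not> segment_matching X (H \<union> Y) N r" using Y nbN by auto
          then have "\<not> segment_matching X Y N r" using segment_matching_mono by blast
          then show "Y \<in> {Y. \<not> (\<exists>f. inj_on f N \<and>
            (\<forall>x\<in>N. f x \<in> R \<and> Y \<inter> edges_between {x} (segments X (f x)) \<noteq> {}))}"
            by (simp add: segment_matching_def R_def)
        qed
      qed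
    qed (use finite_I in auto)
    have "measure_pmf.prob (random_subset I q) {Y. \<exists>r\<in>V. real (card (nb (X \<union> Y \<union> Z) r)) < 3 * L \<and>
        \<not> segment_matching X Y (nb (X \<union> Y \<union> Z) r) r} \<le> real (card V) * (1 / real n ^ 2)"
      using each by (intro prob_exists_le) auto
    then show ?thesis using True n_large by (simp add: segment_failure_def power2_eq_square)
  qed
qed

end

section \<open>Matchings at all vertices\<close>

context random_rounds
begin

text \<open>Branches of size \<open>s\<close> are hit by a vertex with probability bounded below;
  the vertices outside all branches provide the spare neighbours for the matchings.\<close>

definition roomy :: "nat set set \<Rightarrow> nat set \<Rightarrow> nat \<Rightarrow> nat \<Rightarrow> (nat \<Rightarrow> nat set) \<times> (nat \<Rightarrow> nat) \<Rightarrow> bool" where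
  "roomy E N r k Dd \<longleftrightarrow> branch_structure V E r N k (fst Dd) (snd Dd) \<and> (\<forall>i<k. s \<le> card (fst Dd i)) \<and>
     real n / 250 < real (card (V - (\<Union>i<k. fst Dd i)))"

text \<open>
  The choice depends only on the first two rounds and on the neighbourhood of \<open>r\<close>, so it is not
  affected by conditioning on these and leaves the remaining edges of the third round random.
\<close>

definition chosen :: "nat set set \<Rightarrow> nat set \<Rightarrow> nat \<Rightarrow> nat \<Rightarrow> (nat \<Rightarrow> nat set) \<times> (nat \<Rightarrow> nat)" where
  "chosen E N r k = (SOME Dd. roomy E N r k Dd)"

definition structured :: "nat set set \<Rightarrow> nat set \<Rightarrow> nat \<Rightarrow> nat \<Rightarrow> bool" where
  "structured E N r k \<longleftrightarrow> (\<exists>Dd. roomy E N r k Dd)"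

lemma chosen: "structured E N r k \<Longrightarrow> roomy E N r k (chosen E N r k)"
  unfolding structured_def chosen_def by (rule someI_ex)

lemma structured_exists:
  assumes XYZ: "X \<subseteq> I" "Y \<subseteq> I" "Z \<subseteq> I" and ok: "\<not> degree_failure (X \<union> Y \<union> Z)" "expanding X"
      "\<not> segment_failure X Y Z"
    and r: "r \<in> V" and k: "1 \<le> k" "k \<le> card (nb (X \<union> Y \<union> Z) r)"
  shows "structured (X \<union> Y) (nb (X \<union> Y \<union> Z) r) r k"
proof -
  define N where "N = nb (X \<union> Y \<union> Z) r"
  have N_V: "N \<subseteq> V - {r}" using nb_subset[of "X \<union> Y \<union> Z" V r] XYZ by (auto simp: N_def)
  then have fN: "finite N" by (rule finite_subset) simp
  have kN: "k \<le> card N" using k by (simp add: N_def)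
  have deg: "\<not> (if 1 / 40 < p then real (card (V - N)) \<le> real n / 250 else 3 * L \<le> real (card N))"
    using ok(1) r unfolding degree_failure_def N_def by blast
  show ?thesis
  proof (cases "1 / 40 < p")
    case True
    have room: "real n / 250 < real (card (V - N))"
      using deg True by simp
    \<comment> \<open>In the dense case \<open>s = 1\<close>, so that a single neighbour of
      \<open>r\<close> is a branch of sufficient size.\<close>
    have "1 / (40 * p) \<le> 1" using True by simp
    then have "s = 1" using s_pos by (simp add: s_def nat_le_iff ceiling_le_iff le_antisym)
    obtain D d where Dd: "branch_structure V (X \<union> Y) r N k D d" "(\<Union>i<k. D i) = N"
      "\<forall>i<k. \<exists>x\<in>N. {x} \<subseteq> D i"
      using branch_structure_exists[OF N_V fN k(1) kN, of "\<lambda>_. {}" "X \<union> Y"]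
      by (auto simp: disjoint_family_on_def)
    have "s \<le> card (D i)" if "i < k" for i
    proof -
      have "D i \<subseteq> V - {r} \<and> D i \<inter> N \<noteq> {}" using Dd(1) that unfolding branch_structure_def by simp
      then have "D i \<subseteq> V" "D i \<noteq> {}" by auto
      then have "card (D i) > 0" by (simp add: card_gt_0_iff finite_subset)
      then show ?thesis by (simp add: \<open>s = 1\<close>)
    qed
    then have "roomy (X \<union> Y) N r k (D, d)" using Dd room by (simp add: roomy_def)
    then show ?thesis unfolding structured_def N_def by blast
  next
    case False
    then have sparse: "p \<le> 1 / 40" by simp
    note seg = segments[OF sparse ok(2)]
    have small: "real (card N) < 3 * L" using deg False by simp
    then have "segment_matching X Y N r" using ok(2,3) sparse r by (auto simp: segment_failure_def N_def)
    then obtain f where f: "inj_on f N" "\<And>x. x \<in> N \<Longrightarrow> f x \<in> free_segments X N r"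
        "\<And>x. x \<in> N \<Longrightarrow> Y \<inter> edges_between {x} (segments X (f x)) \<noteq> {}"
      unfolding segment_matching_def by blast
    define Q where "Q = (\<lambda>x. segments X (f x))"
    have fK: "f x < K" "Q x \<inter> insert r N = {}" if "x \<in> N" for x
      using f(2)[OF that] by (auto simp: free_segments_def Q_def)
    have Q: "Q x \<subseteq> V - {r} - N" "card (Q x) = s" "finite (Q x)" if "x \<in> N" for x
      using seg(1,2)[of "f x"] fK[OF that] by (auto simp: Q_def intro: finite_subset[OF seg(1)])
    have disj: "disjoint_family_on Q N"
      using seg(4) f(1) fK(1) unfolding disjoint_family_on_def Q_def by (metis inj_onD lessThan_iff)
    have link: "finite (Q x) \<and> linked (X \<union> Y) (Q x) \<and> (\<exists>y\<in>Q x. {x, y} \<in> X \<union> Y)" if "x \<in> N" for x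
    proof (intro conjI)
      show "finite (Q x)" using Q(3)[OF that] .
      show "linked (X \<union> Y) (Q x)" using seg(3)[of "f x"] fK[OF that] unfolding Q_def linked_def by blast
      show "\<exists>y\<in>Q x. {x, y} \<in> X \<union> Y" using f(3)[OF that] by (auto simp: Q_def elim!: edges_betweenE)
    qed
    obtain D d where Dd: "branch_structure V (X \<union> Y) r N k D d" "(\<Union>i<k. D i) = N \<union> (\<Union>x\<in>N. Q x)"
      "\<forall>i<k. \<exists>x\<in>N. insert x (Q x) \<subseteq> D i"
      using branch_structure_exists[OF N_V fN k(1) kN Q(1) disj link] by blast
    have "s \<le> card (D i)" if i: "i < k" for i
    proof -
      obtain x where x: "x \<in> N" "Q x \<subseteq> D i" using Dd(3) i by blast
      have "D i \<subseteq> V" using Dd(1) i unfolding branch_structure_def by blast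
      then have "finite (D i)" by (rule finite_subset) simp
      then show ?thesis using card_mono[of "D i" "Q x"] x Q(2) by simp
    qed
    moreover have "real n / 250 < real (card (V - (\<Union>i<k. D i)))"
    proof -
      \<comment> \<open>The branches have at most \<open>3 * L + 3 * n / 20\<close> vertices in
        total, where \<open>L \<le> n / 40\<close>.\<close>
      have "card (\<Union>x\<in>N. Q x) \<le> (\<Sum>x\<in>N. card (Q x))" by (rule card_UN_le[OF fN])
      also have "\<dots> = card N * s" using Q(2) by simp
      finally have "card (N \<union> (\<Union>x\<in>N. Q x)) \<le> card N + card N * s"
        using card_Un_le[of N "\<Union>x\<in>N. Q x"] by linarith
      then have "real (card (\<Union>i<k. D i)) \<le> real (card N + card N * s)" unfolding Dd(2) by (rule of_nat_mono)
      also have "\<dots> = real (card N) * (1 + real s)" by (simp add: algebra_simps)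
      also have "\<dots> \<le> 3 * L * (1 + 1 / (20 * p))"
        using small s_le_sparse[OF sparse] L_large by (intro mult_mono) auto
      also have "\<dots> = 3 * L + 3 * real n / 20" using p_pos by (simp add: L_def field_simps)
      also have "\<dots> \<le> 9 * real n / 40"
        using sparse mult_left_mono[of p "1 / 40" "real n"] by (simp add: L_def mult.commute)
      finally have core: "real (card (\<Union>i<k. D i)) \<le> 9 * real n / 40" .
      have "n \<le> card (V - (\<Union>i<k. D i)) + card (\<Union>i<k. D i)"
      proof -
        have "finite (\<Union>i<k. D i)" unfolding Dd(2) using fN Q(3) by auto
        then show ?thesis using diff_card_le_card_Diff[of "\<Union>i<k. D i" V] by simp
      qed
      then show ?thesis using core n_large by linarith
    qed
    ultimately have "roomy (X \<union> Y) N r k (D, d)" using Dd by (simp add: roomy_def)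
    then show ?thesis unfolding structured_def N_def by blast
  qed
qed

definition core :: "nat set set \<Rightarrow> nat set \<Rightarrow> nat \<Rightarrow> nat \<Rightarrow> nat set" where
  "core E N r k = (\<Union>i<k. fst (chosen E N r k) i)"

text \<open>Neighbours outside the core and different from \<open>r\<close> are not values of
  \<open>up_vertex\<close> at indices in \<open>branch_index\<close>, so they remain candidates for
  the matching at \<open>v\<close>. Counting those in \<open>Z\<close> only leaves the count random
  once \<open>X\<close> and \<open>Y\<close> are fixed.\<close>

definition spare_failure :: "nat set set \<Rightarrow> nat set set \<Rightarrow> nat set set \<Rightarrow> bool" where
  "spare_failure X Y Z \<longleftrightarrow> (\<exists>r\<in>V. \<exists>v\<in>V - {r}. \<exists>k\<in>{..n}. structured (X \<union> Y) (nb (X \<union> Y \<union> Z) r) r k \<and>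
     real (card (nb Z v \<inter> (V - core (X \<union> Y) (nb (X \<union> Y \<union> Z) r) r k - {r}))) \<le> L / 4000)"

lemma prob_triple_le:
  assumes "\<And>r v k. r \<in> V \<Longrightarrow> v \<in> V - {r} \<Longrightarrow> k \<in> {..n} \<Longrightarrow> measure_pmf.prob M {x. P r v k x} \<le> 1 / real n ^ 5"
  shows "measure_pmf.prob M {x. \<exists>r\<in>V. \<exists>v\<in>V - {r}. \<exists>k\<in>{..n}. P r v k x} \<le> 1 / real n"
proof -
  have n0: "0 < real n" using n_large by simp
  have "measure_pmf.prob M {x. \<exists>r\<in>V. \<exists>v\<in>V - {r}. \<exists>k\<in>{..n}. P r v k x} \<le>
      real (card V) * (real (n - 1) * (real (card {..n}) * (1 / real n ^ 5)))"
  proof (rule prob_exists_le)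
    fix r assume r: "r \<in> V"
    then have c: "n - 1 = card (V - {r})" by simp
    show "measure_pmf.prob M {x. \<exists>v\<in>V - {r}. \<exists>k\<in>{..n}. P r v k x} \<le>
        real (n - 1) * (real (card {..n}) * (1 / real n ^ 5))"
      unfolding c using assms r by (intro prob_exists_le) auto
  qed simp
  \<comment> \<open>\<open>n - 1\<close> choices of \<open>v\<close> times \<open>n + 1\<close>
    choices of \<open>k\<close> stay below \<open>n ^ 2\<close>.\<close>
  also have "\<dots> = real n * ((real n - 1) * (real n + 1)) * (1 / real n ^ 5)"
    using n_large by (simp add: of_nat_diff)
  also have "\<dots> \<le> real n * (real n * real n) * (1 / real n ^ 5)"
    by (intro mult_right_mono mult_left_mono) (auto simp: algebra_simps)
  also have "\<dots> = 1 / real n ^ 2" using n0 by (simp add: field_simps eval_nat_numeral)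
  also have "\<dots> \<le> 1 / real n" using n_large by (simp add: power2_eq_square field_simps)
  finally show ?thesis .
qed

lemma prob_spare_failure: "measure_pmf.prob (rounds I q) {(X, Y, Z). spare_failure X Y Z} \<le> 1 / real n"
proof (rule rounds_le_trd)
  fix X Y assume XY: "X \<subseteq> I" "Y \<subseteq> I"
  show "measure_pmf.prob (random_subset I q) {Z. spare_failure X Y Z} \<le> 1 / real n"
    unfolding spare_failure_def
  proof (rule prob_triple_le)
    fix r v k assume r: "r \<in> V" and v: "v \<in> V - {r}"
    \<comment> \<open>These edges at \<open>v\<close> avoid \<open>r\<close>, so they affect neither
      its neighbourhood nor the core.\<close>
    define B where "B = edges_between {v} (V - {r, v})"
    have BI: "B \<subseteq> I" unfolding B_def using v by (intro star_edges) auto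
    show "measure_pmf.prob (random_subset I q) {Z. structured (X \<union> Y) (nb (X \<union> Y \<union> Z) r) r k \<and>
      real (card (nb Z v \<inter> (V - core (X \<union> Y) (nb (X \<union> Y \<union> Z) r) r k - {r}))) \<le> L / 4000} \<le> 1 / real n ^ 5"
    proof (rule random_subset_condition[OF finite_I BI])
      fix H assume H: "H \<subseteq> I - B"
      define N where "N = nb (X \<union> Y \<union> H) r"
      have nbN: "nb (X \<union> Y \<union> (H \<union> Z)) r = N" if "Z \<subseteq> B" for Z
      proof -
        have "nb Z r = {}" using that v by (intro nb_avoid) (auto simp: B_def elim!: edges_betweenE)
        then show ?thesis by (simp add: N_def nb_Un Un_assoc)
      qed
      show "measure_pmf.prob (random_subset B q) {Z. structured (X \<union> Y) (nb (X \<union> Y \<union> (H \<union> Z)) r) r k \<and>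
        real (card (nb (H \<union> Z) v \<inter> (V - core (X \<union> Y) (nb (X \<union> Y \<union> (H \<union> Z)) r) r k - {r}))) \<le> L / 4000}
        \<le> 1 / real n ^ 5"
      proof (cases "structured (X \<union> Y) N r k")
        case False
        show ?thesis
          by (rule prob_le_on_support[where S' = "{}"])
            (use False nbN set_pmf_random_subset[of B q] in auto)
      next
        case True
        define W where "W = V - core (X \<union> Y) N r k"
        define T where "T = edges_between {v} (W - {r, v})"
        have room: "real n / 250 < real (card W)"
          using chosen[OF True] by (simp add: roomy_def W_def core_def)
        have "card T = card (W - {r, v})" by (simp add: T_def card_edges_between)
        moreover have "card W - card {r, v} \<le> card (W - {r, v})" by (rule diff_card_le_card_Diff) simp
        moreover have "card {r, v} \<le> 2" by (simp add: card_insert_if)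
        ultimately have cT: "real n / 300 \<le> real (card T)" using room n_large by linarith
        have TB: "T \<subseteq> B" by (auto simp: T_def B_def W_def edges_between_def)
        have "measure_pmf.prob (random_subset B q) {Z. real (card (Z \<inter> T)) \<le> L / 4000} \<le>
            2 powr (L / 4000) * exp (- q * real (card T) / 2)"
          using BI finite_I finite_subset q_bounds TB by (intro random_subset_lower_tail) auto
        \<comment> \<open>At least \<open>L / 900\<close> hits are expected. Half of this, the
          exponent of the tail bound, exceeds \<open>L / 4000\<close> by more than
          \<open>L / 10000\<close>.\<close>
        also have "\<dots> \<le> exp (L / 4000) * exp (- L / 1800)"
        proof (intro mult_mono)
          have "ln 2 * (L / 4000) \<le> 1 * (L / 4000)"
            using ln2_le_25_over_36 L_large by (intro mult_right_mono) auto
          then show "2 powr (L / 4000) \<le> exp (L / 4000)" by (simp add: powr_def mult.commute)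
          have "L / 900 = p / 3 * (real n / 300)" by (simp add: L_def)
          also have "\<dots> \<le> q * real (card T)" using q_ge cT p_pos q_bounds by (intro mult_mono) auto
          finally show "exp (- q * real (card T) / 2) \<le> exp (- L / 1800)" by simp
        qed auto
        also have "\<dots> = exp (L / 4000 - L / 1800)" by (simp add: exp_add[symmetric])
        also have "\<dots> \<le> exp (- (1 / 10000 * L))" using L_large by simp
        also have "\<dots> \<le> 1 / real n ^ 5" by (rule exp_tail) auto
        finally have *: "measure_pmf.prob (random_subset B q) {Z. real (card (Z \<inter> T)) \<le> L / 4000} \<le> 1 / real n ^ 5" .
        show ?thesis
        proof (rule prob_le_on_support[OF _ *])
          fix Z assume "Z \<in> set_pmf (random_subset B q)"
            and Z: "Z \<in> {Z. structured (X \<union> Y) (nb (X \<union> Y \<union> (H \<union> Z)) r) r k \<and>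
              real (card (nb (H \<union> Z) v \<inter> (V - core (X \<union> Y) (nb (X \<union> Y \<union> (H \<union> Z)) r) r k - {r}))) \<le> L / 4000}"
          then have ZB: "Z \<subseteq> B" using set_pmf_random_subset by blast
          have "card (Z \<inter> T) = card (nb Z v \<inter> (W - {r, v}))" unfolding T_def by (rule card_Int_star)
          also have "\<dots> \<le> card (nb (H \<union> Z) v \<inter> (W - {r}))"
            by (intro card_mono) (auto simp: W_def nb_Un)
          finally show "Z \<in> {Z. real (card (Z \<inter> T)) \<le> L / 4000}"
            using Z nbN[OF ZB] by (simp add: W_def)
        qed
      qed
    qed
  qed
qed

section \<open>Matching the remaining indices to neighbours of a vertex\<close>

definition first_steps :: "nat set set \<Rightarrow> nat \<Rightarrow> nat \<Rightarrow> (nat \<Rightarrow> nat set) \<times> (nat \<Rightarrow> nat) \<Rightarrow> nat \<Rightarrow> nat set" where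
  "first_steps E r k Dd v = nb E v - {r} - up_vertex E r (fst Dd) (snd Dd) v ` branch_index E r k (fst Dd) v"

definition step_matching ::
    "nat set set \<Rightarrow> nat set set \<Rightarrow> nat \<Rightarrow> nat \<Rightarrow> (nat \<Rightarrow> nat set) \<times> (nat \<Rightarrow> nat) \<Rightarrow> nat \<Rightarrow> bool" where
  "step_matching E Z r k Dd v \<longleftrightarrow> (\<exists>f. inj_on f ({..<k} - branch_index E r k (fst Dd) v) \<and>
     (\<forall>i\<in>{..<k} - branch_index E r k (fst Dd) v.
        f i \<in> first_steps E r k Dd v \<and> Z \<inter> edges_between {f i} (fst Dd i) \<noteq> {}))"

lemma step_matching_mono: "step_matching E Z r k Dd v \<Longrightarrow> Z \<subseteq> Z' \<Longrightarrow> step_matching E Z' r k Dd v"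
  unfolding step_matching_def by blast

text \<open>For a fixed \<open>Z\<close>, the graph enters only through the neighbourhoods of
  \<open>r\<close> and \<open>v\<close>, so edges avoiding both can be redrawn.\<close>

lemma step_cong:
  assumes "nb E r = nb F r" "nb E v = nb F v"
  shows "first_steps E r k Dd v = first_steps F r k Dd v"
    "branch_index E r k D v = branch_index F r k D v"
    "step_matching E Z r k Dd v \<longleftrightarrow> step_matching F Z r k Dd v"
proof -
  have J: "branch_index E r k D v = branch_index F r k D v" for D
    using assms by (simp add: branch_index_def)
  have "up_vertex E r D d v = up_vertex F r D d v" for D d
    using assms by (simp add: up_vertex_def fun_eq_iff)
  then have S: "first_steps E r k Dd v = first_steps F r k Dd v" using J assms by (simp add: first_steps_def)
  show "first_steps E r k Dd v = first_steps F r k Dd v" by (rule S)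
  show "branch_index E r k D v = branch_index F r k D v" by (rule J)
  show "step_matching E Z r k Dd v \<longleftrightarrow> step_matching F Z r k Dd v" unfolding step_matching_def J S ..
qed

text \<open>The cardinality conditions make the event unlikely for every \<open>k\<close>. When
  \<open>k\<close> is the minimum degree, they follow from \<open>card_J_le\<close> and from the
  absence of a spare failure.\<close>

definition step_failure_at :: "nat set set \<Rightarrow> nat set set \<Rightarrow> nat \<Rightarrow> nat \<Rightarrow> (nat \<Rightarrow> nat set) \<times> (nat \<Rightarrow> nat) \<Rightarrow> nat \<Rightarrow> bool" where
  "step_failure_at E Z r k Dd v \<longleftrightarrow>
     card ({..<k} - branch_index E r k (fst Dd) v) \<le> card (first_steps E r k Dd v) \<and>
     L / 4000 \<le> real (card (first_steps E r k Dd v)) \<and> \<not> step_matching E Z r k Dd v"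

definition step_failure :: "nat set set \<Rightarrow> nat set set \<Rightarrow> nat set set \<Rightarrow> bool" where
  "step_failure X Y Z \<longleftrightarrow> (\<exists>r\<in>V. \<exists>v\<in>V - {r}. \<exists>k\<in>{..n}. structured (X \<union> Y) (nb (X \<union> Y \<union> Z) r) r k \<and>
     step_failure_at (X \<union> Y \<union> Z) Z r k (chosen (X \<union> Y) (nb (X \<union> Y \<union> Z) r) r k) v)"

text \<open>All edges at \<open>r\<close> and \<open>v\<close> are revealed. For an index in
  \<open>F\<close> the branch contains neither \<open>v\<close> nor a neighbour of \<open>v\<close>,
  so it is disjoint from \<open>R\<close>, and its edges to \<open>R\<close> are still random in the
  third round.\<close>

lemma prob_step_failure: "measure_pmf.prob (rounds I q) {(X, Y, Z). step_failure X Y Z} \<le> 1 / real n"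
proof (rule rounds_le_trd)
  fix X Y assume XY: "X \<subseteq> I" "Y \<subseteq> I"
  show "measure_pmf.prob (random_subset I q) {Z. step_failure X Y Z} \<le> 1 / real n"
    unfolding step_failure_def
  proof (rule prob_triple_le)
    fix r v k assume r: "r \<in> V" and v: "v \<in> V - {r}"
    define B where "B = {e \<in> I. r \<notin> e \<and> v \<notin> e}"
    have BI: "B \<subseteq> I" by (auto simp: B_def)
    show "measure_pmf.prob (random_subset I q) {Z. structured (X \<union> Y) (nb (X \<union> Y \<union> Z) r) r k \<and>
      step_failure_at (X \<union> Y \<union> Z) Z r k (chosen (X \<union> Y) (nb (X \<union> Y \<union> Z) r) r k) v} \<le> 1 / real n ^ 5"
    proof (rule random_subset_condition[OF finite_I BI])
      fix H assume H: "H \<subseteq> I - B"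
      define G where "G = X \<union> Y \<union> H"
      define N where "N = nb G r"
      define Dd where "Dd = chosen (X \<union> Y) N r k"
      have GI: "G \<subseteq> I" using XY H by (auto simp: G_def)
      have nbG: "nb (X \<union> Y \<union> (H \<union> Z)) r = nb G r" "nb (X \<union> Y \<union> (H \<union> Z)) v = nb G v" if "Z \<subseteq> B" for Z
      proof -
        have "nb Z r = {}" "nb Z v = {}" using that by (auto simp: B_def intro!: nb_avoid)
        then show "nb (X \<union> Y \<union> (H \<union> Z)) r = nb G r" "nb (X \<union> Y \<union> (H \<union> Z)) v = nb G v"
          by (simp_all add: G_def nb_Un Un_assoc)
      qed
      define F where "F = {..<k} - branch_index G r k (fst Dd) v"
      define R where "R = first_steps G r k Dd v"
      have fail: "structured (X \<union> Y) N r k \<and> card F \<le> card R \<and> L / 4000 \<le> real (card R) \<and>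
          \<not> step_matching G Z r k Dd v"
        if "Z \<subseteq> B" "structured (X \<union> Y) (nb (X \<union> Y \<union> (H \<union> Z)) r) r k"
          "step_failure_at (X \<union> Y \<union> (H \<union> Z)) (H \<union> Z) r k (chosen (X \<union> Y) (nb (X \<union> Y \<union> (H \<union> Z)) r) r k) v" for Z
      proof -
        note eq = step_cong[OF nbG[OF that(1)]]
        have "\<not> step_matching G (H \<union> Z) r k Dd v"
          using that(3) unfolding step_failure_at_def eq nbG[OF that(1)] Dd_def N_def by blast
        then have "\<not> step_matching G Z r k Dd v" using step_matching_mono by blast
        then show ?thesis
          using that(2,3) unfolding step_failure_at_def eq nbG[OF that(1)] Dd_def N_def F_def R_def by blast
      qed
      show "measure_pmf.prob (random_subset B q) {Z. structured (X \<union> Y) (nb (X \<union> Y \<union> (H \<union> Z)) r) r k \<and>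
        step_failure_at (X \<union> Y \<union> (H \<union> Z)) (H \<union> Z) r k (chosen (X \<union> Y) (nb (X \<union> Y \<union> (H \<union> Z)) r) r k) v}
        \<le> 1 / real n ^ 5"
      proof (cases "structured (X \<union> Y) N r k \<and> card F \<le> card R \<and> L / 4000 \<le> real (card R)")
        case False
        show ?thesis
          by (rule prob_le_on_support[where S' = "{}"])
            (use False fail set_pmf_random_subset[of B q] in auto)
      next
        case True
        then have room: "roomy (X \<union> Y) N r k Dd" unfolding Dd_def by (intro chosen) blast
        have D_card: "s \<le> card (fst Dd i)" if "i < k" for i using room that by (simp add: roomy_def)
        have br: "branching V G r k (fst Dd) (snd Dd)"
          using room r GI branch_structure_branching[of V "X \<union> Y" r G k "fst Dd" "snd Dd"]
          by (simp add: roomy_def N_def G_def)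
        have D_V: "fst Dd i \<subseteq> V - {r}" if "i < k" for i using branching.D_sub[OF br that] .
        have R_nb: "R \<subseteq> nb G v - {r}" by (auto simp: R_def first_steps_def)
        have R_V: "R \<subseteq> V - {r, v}" using R_nb nb_subset[OF GI, of v] by blast
        then have "card R \<le> card V" by (intro card_mono) auto
        then have cR: "card R \<le> n" by simp
        have off: "fst Dd i \<inter> nb G v = {}" "v \<notin> fst Dd i" "i < k" if "i \<in> F" for i
          using that branching.mem_J[OF br, of i v] by (auto simp: F_def branch_index_def)
        have "measure_pmf.prob (random_subset B q) {Z. \<not> (\<exists>f. inj_on f F \<and>
            (\<forall>i\<in>F. f i \<in> R \<and> Z \<inter> edges_between {f i} (fst Dd i) \<noteq> {}))} \<le>
            real (card R) ^ 3 * exp (- q * real s * real (card R) / 2)"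
        proof (rule random_matching)
          show "finite B" using finite_I BI finite_subset by blast
          show "finite R" using R_V by (rule finite_subset) simp
          show "finite F" by (simp add: F_def)
          show "card F \<le> card R" using True by blast
        next
          fix i x assume i: "i \<in> F" and x: "x \<in> R"
          have xD: "x \<notin> fst Dd i" using off(1)[OF i] R_nb x by blast
          have "edges_between {x} (fst Dd i) \<subseteq> I"
            using D_V[OF off(3)[OF i]] xD x R_V by (intro star_edges) auto
          moreover have "r \<notin> e \<and> v \<notin> e" if "e \<in> edges_between {x} (fst Dd i)" for e
            using that x R_V D_V[OF off(3)[OF i]] off(2)[OF i] by (auto elim!: edges_betweenE)
          moreover have "card (edges_between {x} (fst Dd i)) = card (fst Dd i)"
            using xD by (subst card_edges_between) auto
          ultimately show "edges_between {x} (fst Dd i) \<subseteq> B \<and> s \<le> card (edges_between {x} (fst Dd i))"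
            using D_card[OF off(3)[OF i]] by (auto simp: B_def)
        next
          fix i x i' x'
          assume ix: "i \<in> F" "x \<in> R" "i' \<in> F" "x' \<in> R"
            "edges_between {x} (fst Dd i) \<inter> edges_between {x'} (fst Dd i') \<noteq> {}"
          have "fst Dd i \<inter> R = {}" "fst Dd i' \<inter> R = {}" using off(1) ix(1,3) R_nb by blast+
          moreover have "fst Dd i \<inter> fst Dd i' = {}" if "i \<noteq> i'"
            using branching.D_unique[OF br] off(3) ix(1,3) that by blast
          ultimately show "i = i' \<and> x = x'"
            using edges_between_singleton_disjoint[of x R x' "fst Dd" i i'] ix by blast
        qed (use q_bounds in auto)
        also have "\<dots> \<le> 1 / real n ^ 5"
        proof (rule cubic_tail)
          have "1 / 120 * (L / 4000) \<le> q * real s * real (card R)"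
            using True q_bounds L_large by (intro mult_mono qs_ge) auto
          then show "1 / 960000 * L \<le> q * real s * real (card R) / 2" by simp
        qed (use cR in auto)
        finally have *: "measure_pmf.prob (random_subset B q) {Z. \<not> (\<exists>f. inj_on f F \<and>
            (\<forall>i\<in>F. f i \<in> R \<and> Z \<inter> edges_between {f i} (fst Dd i) \<noteq> {}))} \<le> 1 / real n ^ 5" .
        show ?thesis
        proof (rule prob_le_on_support[OF _ *])
          fix Z assume "Z \<in> set_pmf (random_subset B q)"
            and Z: "Z \<in> {Z. structured (X \<union> Y) (nb (X \<union> Y \<union> (H \<union> Z)) r) r k \<and>
              step_failure_at (X \<union> Y \<union> (H \<union> Z)) (H \<union> Z) r k (chosen (X \<union> Y) (nb (X \<union> Y \<union> (H \<union> Z)) r) r k) v}"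
          then have "Z \<subseteq> B" using set_pmf_random_subset by blast
          then have "\<not> step_matching G Z r k Dd v" using fail Z by blast
          then show "Z \<in> {Z. \<not> (\<exists>f. inj_on f F \<and>
              (\<forall>i\<in>F. f i \<in> R \<and> Z \<inter> edges_between {f i} (fst Dd i) \<noteq> {}))}"
            by (simp add: step_matching_def F_def R_def)
        qed
      qed
    qed
  qed
qed

end

section \<open>Conclusion\<close>

context random_rounds
begin

text \<open>The deterministic part, where \<open>k\<close> becomes the minimum degree:
  \<open>k \<le> card (nb E v)\<close> and \<open>card_J_le\<close> give at least as many candidates
  as remaining indices.\<close>

lemma trees_exist:
  assumes XYZ: "X \<subseteq> I" "Y \<subseteq> I" "Z \<subseteq> I" and ok: "\<not> degree_failure (X \<union> Y \<union> Z)" "expanding X"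
      "\<not> segment_failure X Y Z" "\<not> spare_failure X Y Z" "\<not> step_failure X Y Z"
    and r: "r \<in> V"
  shows "\<exists>\<T>. card \<T> = min_degree V (X \<union> Y \<union> Z) \<and> independent_spanning_trees V (X \<union> Y \<union> Z) r \<T>"
proof -
  define E where "E = X \<union> Y \<union> Z"
  define k where "k = min_degree V E"
  have EI: "E \<subseteq> I" using XYZ by (auto simp: E_def)
  have nb_V: "nb E v \<subseteq> V" for v using nb_subset[OF EI] by blast
  have deg: "k \<le> card (nb E v)" if "v \<in> V" for v
    unfolding k_def min_degree_def vertex_degree_eq_card_nb[OF EI, symmetric] using that by (intro Min_le) auto
  show ?thesis
  \<comment> \<open>Without indices, branches cannot cover a nonempty neighbourhood of
    \<open>r\<close>; the empty family of trees is then the witness.\<close>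
  proof (cases "k = 0")
    case True
    then show ?thesis
      by (intro exI[of _ "{}"]) (simp add: k_def E_def independent_spanning_trees_def)
  next
    case False
    define N where "N = nb E r"
    define Dd where "Dd = chosen (X \<union> Y) N r k"
    have st: "structured (X \<union> Y) N r k"
      unfolding N_def E_def using False deg[OF r] by (intro structured_exists XYZ ok r) (auto simp: E_def)
    have room: "roomy (X \<union> Y) N r k Dd" unfolding Dd_def by (rule chosen[OF st])
    have "card (nb E r) \<le> card V" by (intro card_mono nb_V) simp
    then have kn: "k \<in> {..n}" using deg[OF r] by simp
    interpret branching V E r k "fst Dd" "snd Dd"
      using room r EI branch_structure_branching[of V "X \<union> Y" r E k "fst Dd" "snd Dd"]
      by (auto simp: roomy_def N_def E_def)
    have "\<exists>\<T>. card \<T> = k \<and> independent_spanning_trees V E r \<T>"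
    proof (rule independent)
      fix v assume v: "v \<in> V - {r}"
      let ?R = "first_steps E r k Dd v"
      have R_fin: "finite ?R" by (rule finite_subset[OF _ finite_V]) (use nb_V in \<open>auto simp: first_steps_def\<close>)
      have "nb Z v \<inter> (V - core (X \<union> Y) N r k - {r}) \<subseteq> ?R"
      proof
        fix x assume x: "x \<in> nb Z v \<inter> (V - core (X \<union> Y) N r k - {r})"
        have "x \<noteq> up v i" if "i \<in> J v" for i
          using x up_cases[OF that] J_less[OF that] by (auto simp: core_def Dd_def[symmetric])
        then show "x \<in> ?R" using x by (auto simp: first_steps_def E_def nb_Un)
      qed
      then have "card (nb Z v \<inter> (V - core (X \<union> Y) N r k - {r})) \<le> card ?R" by (intro card_mono R_fin)
      moreover have "\<not> real (card (nb Z v \<inter> (V - core (X \<union> Y) N r k - {r}))) \<le> L / 4000"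
        using ok(4) r v kn st unfolding spare_failure_def N_def E_def by blast
      ultimately have spare: "L / 4000 \<le> real (card ?R)" by linarith
      have "card ({..<k} - J v) = k - card (J v)"
        using J_less finite_J by (subst card_Diff_subset) auto
      also have "\<dots> \<le> card ?R"
        using card_J_le[of v] deg[of v] v by (simp add: first_steps_def)
      finally have "card ({..<k} - J v) \<le> card ?R" .
      moreover have "\<not> step_failure_at E Z r k Dd v"
        using ok(5) r v kn st unfolding step_failure_def N_def E_def Dd_def by blast
      ultimately have "step_matching E Z r k Dd v" using spare by (simp add: step_failure_at_def)
      then obtain f where f: "inj_on f ({..<k} - J v)"
        "\<And>i. i \<in> {..<k} - J v \<Longrightarrow> f i \<in> ?R \<and> Z \<inter> edges_between {f i} (fst Dd i) \<noteq> {}"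
        unfolding step_matching_def by blast
      have "i \<in> J (f i)" if i: "i \<in> {..<k} - J v" for i
      proof -
        obtain y where "y \<in> fst Dd i" "{f i, y} \<in> Z" using f(2)[OF i] by (auto elim!: edges_betweenE)
        then have "y \<in> fst Dd i \<inter> nb E (f i)" by (simp add: nb_def E_def)
        then show ?thesis using i by (auto simp: branch_index_def)
      qed
      then show "\<exists>f. inj_on f ({..<k} - J v) \<and>
          (\<forall>i \<in> {..<k} - J v. f i \<in> nb E v - {r} - up v ` J v \<and> i \<in> J (f i))"
        using f unfolding first_steps_def by blast
    qed
    then show ?thesis by (simp add: k_def E_def)
  qed
qed

lemma prob_trees_exist:
  "1 - 5 / real n \<le> measure_pmf.prob (binomial_random_graph n p)
     {E. \<forall>r\<in>V. \<exists>\<T>. card \<T> = min_degree V E \<and> independent_spanning_trees V E r \<T>}"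
    (is "_ \<le> measure_pmf.prob _ ?good")
proof -
  let ?U = "\<lambda>(X, Y, Z). X \<union> Y \<union> Z :: nat set set"
  let ?P = "measure_pmf.prob (rounds I q)"
  have map: "binomial_random_graph n p = map_pmf ?U (rounds I q)"
    unfolding binomial_random_graph_eq using rounds_union[OF finite_I q_bounds q_cube] by simp
  let ?A1 = "{(X, Y, Z). degree_failure (X \<union> Y \<union> Z)}"
  let ?A2 = "{(X, Y, Z). \<not> expanding X} :: (nat set set \<times> nat set set \<times> nat set set) set"
  let ?A3 = "{(X, Y, Z). segment_failure X Y Z}"
  let ?A4 = "{(X, Y, Z). spare_failure X Y Z}"
  let ?A5 = "{(X, Y, Z). step_failure X Y Z}"
  have "?A1 = ?U -` {E. degree_failure E}" by auto
  then have "?P ?A1 \<le> 1 / real n"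
    using prob_degree_failure unfolding rounds_union[OF finite_I q_bounds q_cube, symmetric] by simp
  moreover have "?P ?A2 \<le> 1 / real n" by (rule rounds_le_fst[OF prob_not_expanding])
  moreover have "?P (?A1 \<union> ?A2 \<union> ?A3 \<union> ?A4 \<union> ?A5) \<le> ?P ?A1 + ?P ?A2 + ?P ?A3 + ?P ?A4 + ?P ?A5"
  proof -
    have Un: "?P (A \<union> B) \<le> ?P A + ?P B" for A B by (rule measure_Un_le) auto
    show ?thesis
      using Un[of "?A1 \<union> ?A2 \<union> ?A3 \<union> ?A4" ?A5] Un[of "?A1 \<union> ?A2 \<union> ?A3" ?A4] Un[of "?A1 \<union> ?A2" ?A3]
        Un[of ?A1 ?A2] by linarith
  qed
  ultimately have bad: "?P (?A1 \<union> ?A2 \<union> ?A3 \<union> ?A4 \<union> ?A5) \<le> 5 / real n"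
    using prob_segment_failure prob_spare_failure prob_step_failure by linarith
  have "?P (- (?U -` ?good)) \<le> 5 / real n"
  proof (rule prob_le_on_support[OF _ bad])
    fix w assume w: "w \<in> set_pmf (rounds I q)" and nw: "w \<in> - (?U -` ?good)"
    obtain X Y Z where XYZ: "w = (X, Y, Z)" by (cases w)
    then have sub: "X \<subseteq> I" "Y \<subseteq> I" "Z \<subseteq> I" using set_pmf_rounds w by blast+
    have "\<not> (\<forall>r\<in>V. \<exists>\<T>. card \<T> = min_degree V (X \<union> Y \<union> Z) \<and> independent_spanning_trees V (X \<union> Y \<union> Z) r \<T>)"
      using nw by (simp add: XYZ)
    then have "degree_failure (X \<union> Y \<union> Z) \<or> \<not> expanding X \<or> segment_failure X Y Z \<or> spare_failure X Y Z \<or> step_failure X Y Z"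
      using trees_exist[OF sub] by blast
    then show "w \<in> ?A1 \<union> ?A2 \<union> ?A3 \<union> ?A4 \<union> ?A5" by (auto simp: XYZ)
  qed
  moreover have "?P (- (?U -` ?good)) = 1 - ?P (?U -` ?good)"
    using measure_pmf.prob_compl[of "?U -` ?good" "rounds I q"] by (simp add: Compl_eq_Diff_UNIV)
  ultimately have "1 - 5 / real n \<le> ?P (?U -` ?good)" by linarith
  then show ?thesis unfolding map measure_map_pmf .
qed

end

theorem theorem1p2:
  shows "\<exists>C::real. C > 1 \<and>
    (\<forall>p :: nat \<Rightarrow> real.
       (\<forall>\<^sub>F n in sequentially. C * ln (real n) / real n \<le> p n \<and> p n \<le> 0.99) \<longrightarrow>
       (\<lambda>n. measure_pmf.prob (binomial_random_graph n (p n))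
              {E. \<forall>r\<in>{..<n}. \<exists>\<T>. card \<T> = min_degree {..<n} E \<and>
                                   independent_spanning_trees {..<n} E r \<T>})
         \<longlonglongrightarrow> 1)"
proof (intro exI[of _ "10000000 :: real"] conjI allI impI)
  show "(1::real) < 10000000" by simp
next
  fix p :: "nat \<Rightarrow> real"
  assume p: "\<forall>\<^sub>F n in sequentially. 10000000 * ln (real n) / real n \<le> p n \<and> p n \<le> 0.99"
  let ?f = "\<lambda>n. measure_pmf.prob (binomial_random_graph n (p n))
    {E. \<forall>r\<in>{..<n}. \<exists>\<T>. card \<T> = min_degree {..<n} E \<and> independent_spanning_trees {..<n} E r \<T>}"
  have tail: "\<forall>\<^sub>F n in sequentially.
      real n * (2 powr (real n / 250) * exp (- (real n - 1) / 200)) \<le> 1 / real n"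
  \<comment> \<open>A rational bound on \<open>ln 2\<close> turns the power of 2 into
    \<open>exp (n / 360)\<close>, which is beaten by \<open>exp (- (n - 1) / 200)\<close>.\<close>
  proof (rule eventually_mono)
    show "\<forall>\<^sub>F n in sequentially. real n * (exp (real n / 360) * exp (- (real n - 1) / 200)) \<le> 1 / real n"
      by real_asymp
    fix n :: nat
    assume n: "real n * (exp (real n / 360) * exp (- (real n - 1) / 200)) \<le> 1 / real n"
    have "real n / 250 * ln 2 \<le> real n / 250 * (25 / 36)"
      using ln2_le_25_over_36 by (intro mult_left_mono) auto
    then have "2 powr (real n / 250) \<le> exp (real n / 360)" by (simp add: powr_def)
    then have "real n * (2 powr (real n / 250) * exp (- (real n - 1) / 200)) \<le>
        real n * (exp (real n / 360) * exp (- (real n - 1) / 200))"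
      by (intro mult_left_mono mult_right_mono) auto
    with n show "real n * (2 powr (real n / 250) * exp (- (real n - 1) / 200)) \<le> 1 / real n" by linarith
  qed
  have "\<forall>\<^sub>F n in sequentially. 1 - 5 / real n \<le> ?f n"
    using p tail eventually_ge_at_top[of 10000]
  proof eventually_elim
    case (elim n)
    then have "random_rounds n (p n)"
      by unfold_locales (auto simp: divide_le_eq mult.commute)
    then show ?case by (rule random_rounds.prob_trees_exist)
  qed
  moreover have "(\<lambda>n. 1 - 5 / real n) \<longlonglongrightarrow> 1" by real_asymp
  ultimately show "?f \<longlonglongrightarrow> 1"
    by (intro tendsto_sandwich[of "\<lambda>n. 1 - 5 / real n" ?f sequentially "\<lambda>_. 1" 1]) auto
qed

end
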